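(* Let $0<p<1$ and let $r$ be such that $\frac1r=\frac1p-\frac12$. Let $(\varphi_{ij})_{i,j\in\mathbb N}$ be complex scalars and consider the Schur multiplier $u_\varphi:[x_{ij}]\mapsto[x_{ij}\varphi_{ij}]$. The following are equivalent: (i) $u_\varphi$ is bounded from $S_2$ to $S_p$. (ii) $\varphi$ admits a decomposition $\varphi=\psi+\chi$ with $\sum_i\sup_j|\psi_{ij}|^r<\infty$ and $\sum_j\sup_i|\chi_{ij}|^r<\infty$. (iii) There is a sequence $f_i\ge0$ with $\sum_i f_i<\infty$ such that $|\varphi_{ij}|\le f_i^{1/r}+f_j^{1/r}$ for all $i,j$.
   Context: $S_p$ denotes the Schatten $p$-class of operators on $\ell_2(\mathbb N)$, whose elements are identified with their matrices in the canonical basis; for $0<p<1$ it is a $p$-normed space. *)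

theory Defs
  imports "HOL-Analysis.Analysis"
begin

definition ell2 :: "(nat \<Rightarrow> complex) set" where
  "ell2 = {a. summable (\<lambda>i. (cmod (a i))\<^sup>2)}"

definition ell2_inner :: "(nat \<Rightarrow> complex) \<Rightarrow> (nat \<Rightarrow> complex) \<Rightarrow> complex" where
  "ell2_inner a b = (\<Sum>i. a i * cnj (b i))"

definition orthonormal_seq :: "(nat \<Rightarrow> nat \<Rightarrow> complex) \<Rightarrow> bool" where
  "orthonormal_seq e \<longleftrightarrow>
     (\<forall>n. e n \<in> ell2) \<and> (\<forall>m n. ell2_inner (e m) (e n) = (if m = n then 1 else 0))"

text \<open>
  An operator \<open>T\<close> on \<open>ell2\<close> is represented by its matrix \<open>x i j\<close>, the inner product of
  \<open>T e\<^sub>j\<close> with \<open>e\<^sub>i\<close>.  The compact operators are exactly those with a singular value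
  decomposition (Schmidt expansion) \<open>T = \<Sum>n. s n * \<langle>\<cdot>, v n\<rangle> u n\<close> with \<open>u\<close>, \<open>v\<close> orthonormal and
  \<open>s\<close> decreasing to 0; then \<open>v n\<close> is an eigenvector of \<open>\<bar>T\<bar> = sqrt (T* T)\<close> for the eigenvalue
  \<open>s n\<close>, and \<open>\<bar>T\<bar>\<close> vanishes on the orthogonal complement of the \<open>v n\<close>.  Below the expansion is
  written entrywise; conversely, every such entrywise expansion is the matrix of a compact operator,
  since the series of operators converges in norm.
  Finite rank operators are covered by letting \<open>s\<close> be eventually 0.
\<close>

definition has_singular_values :: "(nat \<Rightarrow> nat \<Rightarrow> complex) \<Rightarrow> (nat \<Rightarrow> real) \<Rightarrow> bool" where
  "has_singular_values x s \<longleftrightarrow>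
     (\<forall>n. 0 \<le> s n) \<and> decseq s \<and> s \<longlonglongrightarrow> 0 \<and>
     (\<exists>u v. orthonormal_seq u \<and> orthonormal_seq v \<and>
        (\<forall>i j. (\<lambda>n. complex_of_real (s n) * u n i * cnj (v n j)) sums x i j))"

text \<open>
  The sequence \<open>s\<close> is uniquely determined by \<open>x\<close>: it lists the nonzero eigenvalues of \<open>\<bar>T\<bar>\<close> in
  decreasing order with multiplicity, followed by zeros if there are only finitely many.
  So the choice below is immaterial for compact operators.
\<close>

definition singular_values :: "(nat \<Rightarrow> nat \<Rightarrow> complex) \<Rightarrow> nat \<Rightarrow> real" where
  "singular_values x = (SOME s. has_singular_values x s)"

definition schatten_class :: "real \<Rightarrow> (nat \<Rightarrow> nat \<Rightarrow> complex) set" where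
  "schatten_class p =
     {x. (\<exists>s. has_singular_values x s) \<and> summable (\<lambda>n. singular_values x n powr p)}"

text \<open>The trace of \<open>\<bar>T\<bar>\<close> to the power \<open>p\<close>, raised to the power \<open>1 / p\<close>.\<close>

definition schatten_norm :: "real \<Rightarrow> (nat \<Rightarrow> nat \<Rightarrow> complex) \<Rightarrow> real" where
  "schatten_norm p x = (\<Sum>n. singular_values x n powr p) powr (1 / p)"

definition schur_mult ::
  "(nat \<Rightarrow> nat \<Rightarrow> complex) \<Rightarrow> (nat \<Rightarrow> nat \<Rightarrow> complex) \<Rightarrow> (nat \<Rightarrow> nat \<Rightarrow> complex)" where
  "schur_mult \<phi> x = (\<lambda>i j. x i j * \<phi> i j)"

definition schatten_bounded ::
  "real \<Rightarrow> real \<Rightarrow> ((nat \<Rightarrow> nat \<Rightarrow> complex) \<Rightarrow> (nat \<Rightarrow> nat \<Rightarrow> complex)) \<Rightarrow> bool" where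
  "schatten_bounded q p U \<longleftrightarrow>
     (\<exists>C. \<forall>x\<in>schatten_class q.
        U x \<in> schatten_class p \<and> schatten_norm p (U x) \<le> C * schatten_norm q x)"

end

theory Submission
  imports Defs
begin

text \<open>
  The sequence \<open>f\<close> of weights in the third condition is the pivot of the proof. It is equivalent to
  the decomposition in the second condition by splitting the matrix at the places where
  \<open>f j \<le> f i\<close> (\<open>decomposition_iff_weights\<close>).

  Weights give boundedness (\<open>schur_mult_bounded_if_weights\<close>). The image of a Hilbert--Schmidt matrix
  \<open>x\<close> is the sum of a part whose rows are dominated by those of \<open>x\<close> times the sequence
  \<open>2 * f i powr (1 / r)\<close> in \<open>\<ell>\<^sub>r\<close>, and a part whose columns are so dominated. For the first part, the
  row norms lie in \<open>\<ell>\<^sub>p\<close> by Hoelder's inequality, and for \<open>p \<le> 2\<close> the \<open>\<ell>\<^sub>p\<close> norm of the rows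
  dominates that of the singular values by Jensen's inequality (\<open>svd_sum_powr_le_rows\<close>). The second
  part is the transposed situation. The two are added by means of the Weyl inequality
  \<open>t (m + n) \<le> a m + b n\<close> (\<open>weyl_singular_value_inequality\<close>), which also yields that the singular
  values are well defined. That the matrices involved have singular values at all is the spectral
  theorem for Hilbert--Schmidt matrices (\<open>hilbert_schmidt_svd_exists\<close>): maximisers of \<open>\<parallel>y w\<parallel>\<close> exist
  because the unit ball is compact and \<open>y\<close> is continuous on it for coordinatewise convergence.

  Boundedness gives weights (\<open>weights_if_schur_mult_bounded\<close>) by testing on matrices supported on a
  single well chosen matching, that is, with at most one nonzero entry in each row and column.
  Choose greedily an almost largest entry of \<open>\<phi>\<close>, delete its row and column, and repeat
  (\<open>greedy_matching\<close>). On matrices supported on this matching the multiplier acts diagonally, and the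
  extremal case of Hoelder's inequality shows that the chosen entries form a sequence in \<open>\<ell>\<^sub>r\<close>
  (\<open>matching_sum_le\<close>). Every other entry is at most twice the chosen entry whose row or column
  removed it, so multiples of the \<open>r\<close>-th powers of the chosen entries, attached to their rows and
  columns, are weights.
\<close>

section \<open>Square summable sequences\<close>

definition sqnorm :: "(nat \<Rightarrow> complex) \<Rightarrow> real" where
  "sqnorm a = (\<Sum>i. (cmod (a i))\<^sup>2)"

lemma sqnorm_sums: "a \<in> ell2 \<Longrightarrow> (\<lambda>i. (cmod (a i))\<^sup>2) sums sqnorm a"
  by (simp add: ell2_def sqnorm_def summable_sums)

lemma sqnorm_nonneg: "a \<in> ell2 \<Longrightarrow> 0 \<le> sqnorm a"
  by (simp add: ell2_def sqnorm_def suminf_nonneg)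

lemma sum_le_sqnorm: "a \<in> ell2 \<Longrightarrow> finite A \<Longrightarrow> (\<Sum>i\<in>A. (cmod (a i))\<^sup>2) \<le> sqnorm a"
  unfolding ell2_def sqnorm_def by (rule sum_le_suminf) auto

lemma coord_le_sqnorm: "a \<in> ell2 \<Longrightarrow> (cmod (a i))\<^sup>2 \<le> sqnorm a"
  using sum_le_sqnorm[of a "{i}"] by simp

lemma ell2_bounded:
  assumes "\<And>N. (\<Sum>i<N. (cmod (a i))\<^sup>2) \<le> B"
  shows "a \<in> ell2" and "sqnorm a \<le> B"
proof -
  show "a \<in> ell2"
    unfolding ell2_def by (auto intro!: summableI_nonneg_bounded assms)
  then show "sqnorm a \<le> B"
    using assms by (auto simp: ell2_def sqnorm_def intro!: suminf_le_const)
qed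

lemma ell2_comparison:
  assumes "b \<in> ell2" and "\<And>i. cmod (a i) \<le> K * cmod (b i)"
  shows "a \<in> ell2" and "sqnorm a \<le> K\<^sup>2 * sqnorm b"
proof -
  have "(cmod (a i))\<^sup>2 \<le> K\<^sup>2 * (cmod (b i))\<^sup>2" for i
    using power_mono[OF assms(2), of i 2] by (simp add: power_mult_distrib)
  then have "(\<Sum>i<N. (cmod (a i))\<^sup>2) \<le> (\<Sum>i<N. K\<^sup>2 * (cmod (b i))\<^sup>2)" for N
    by (intro sum_mono)
  also have "(\<Sum>i<N. K\<^sup>2 * (cmod (b i))\<^sup>2) \<le> K\<^sup>2 * sqnorm b" for N
    by (simp add: sum_distrib_left[symmetric] mult_left_mono sum_le_sqnorm assms)
  finally have "(\<Sum>i<N. (cmod (a i))\<^sup>2) \<le> K\<^sup>2 * sqnorm b" for N .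
  from ell2_bounded[OF this] show "a \<in> ell2" "sqnorm a \<le> K\<^sup>2 * sqnorm b" by auto
qed

lemma ell2_scale: "a \<in> ell2 \<Longrightarrow> (\<lambda>i. k * a i) \<in> ell2"
  by (rule ell2_comparison(1)[where K = "cmod k"]) (auto simp: norm_mult)

lemma sqnorm_scale: "sqnorm (\<lambda>i. k * a i) = (cmod k)\<^sup>2 * sqnorm a" if "a \<in> ell2"
  using that by (simp add: sqnorm_def ell2_def norm_mult power_mult_distrib suminf_mult)

lemma ell2_cnj: "(\<lambda>i. cnj (a i)) \<in> ell2 \<longleftrightarrow> a \<in> ell2"
  by (simp add: ell2_def)

lemma sqnorm_cnj: "sqnorm (\<lambda>i. cnj (a i)) = sqnorm a"
  by (simp add: sqnorm_def)

lemma ell2_zero: "(\<lambda>i. 0) \<in> ell2"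
  by (simp add: ell2_def)

lemma ell2_add:
  assumes "a \<in> ell2" "b \<in> ell2"
  shows "(\<lambda>i. a i + b i) \<in> ell2"
proof -
  have "(cmod (a i + b i))\<^sup>2 \<le> 2 * (cmod (a i))\<^sup>2 + 2 * (cmod (b i))\<^sup>2" for i
  proof -
    have "(cmod (a i + b i))\<^sup>2 \<le> (cmod (a i) + cmod (b i))\<^sup>2"
      by (intro power_mono norm_triangle_ineq) auto
    also have "\<dots> \<le> 2 * (cmod (a i))\<^sup>2 + 2 * (cmod (b i))\<^sup>2"
      using zero_le_power2[of "cmod (a i) - cmod (b i)"] by (simp add: power2_eq_square algebra_simps)
    finally show ?thesis .
  qed
  moreover have "summable (\<lambda>i. 2 * (cmod (a i))\<^sup>2 + 2 * (cmod (b i))\<^sup>2)"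
    using assms by (intro summable_add summable_mult) (auto simp: ell2_def)
  ultimately have "summable (\<lambda>i. (cmod (a i + b i))\<^sup>2)"
    by - (rule summable_comparison_test'[where N = 0], auto)
  then show ?thesis by (simp add: ell2_def)
qed

lemma ell2_diff:
  assumes "a \<in> ell2" "b \<in> ell2"
  shows "(\<lambda>i. a i - b i) \<in> ell2"
  using ell2_add[OF assms(1) ell2_scale[OF assms(2), of "- 1"]] by simp

lemma ell2_sum: "(\<And>k. k \<in> A \<Longrightarrow> f k \<in> ell2) \<Longrightarrow> (\<lambda>i. \<Sum>k\<in>A. f k i) \<in> ell2"
proof (induction A rule: infinite_finite_induct)
  case (insert x A)
  have "(\<lambda>i. f x i + (\<Sum>k\<in>A. f k i)) \<in> ell2" using insert by (intro ell2_add) auto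
  with insert show ?case by simp
qed (simp_all add: ell2_zero)

lemma ell2_lincomb: "(\<And>k. k \<in> A \<Longrightarrow> e k \<in> ell2) \<Longrightarrow> (\<lambda>i. \<Sum>k\<in>A. c k * e k i) \<in> ell2"
  by (intro ell2_sum ell2_scale)

lemma summable_norm_mult_ell2:
  assumes "a \<in> ell2" "b \<in> ell2"
  shows "summable (\<lambda>i. norm (a i * b i))"
proof -
  have "norm (a i * b i) \<le> (cmod (a i))\<^sup>2 + (cmod (b i))\<^sup>2" for i
    unfolding norm_mult using sum_squares_bound[of "cmod (a i)" "cmod (b i)"]
      mult_nonneg_nonneg[OF norm_ge_zero norm_ge_zero, of "a i" "b i"] by linarith
  moreover have "summable (\<lambda>i. (cmod (a i))\<^sup>2 + (cmod (b i))\<^sup>2)"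
    using assms by (intro summable_add) (auto simp: ell2_def)
  ultimately show ?thesis
    by - (rule summable_comparison_test'[where N = 0], auto)
qed

lemma ell2_inner_sums:
  "a \<in> ell2 \<Longrightarrow> b \<in> ell2 \<Longrightarrow> (\<lambda>i. a i * cnj (b i)) sums ell2_inner a b"
  unfolding ell2_inner_def
  by (intro summable_sums summable_norm_cancel[OF summable_norm_mult_ell2]) (auto simp: ell2_cnj)

lemma ell2_inner_add_left:
  "a \<in> ell2 \<Longrightarrow> b \<in> ell2 \<Longrightarrow> c \<in> ell2 \<Longrightarrow>
    ell2_inner (\<lambda>i. a i + b i) c = ell2_inner a c + ell2_inner b c"
  using sums_add[OF ell2_inner_sums[of a c] ell2_inner_sums[of b c]]
  by (simp add: ell2_inner_def algebra_simps sums_iff)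

lemma ell2_inner_scale_left:
  "a \<in> ell2 \<Longrightarrow> c \<in> ell2 \<Longrightarrow> ell2_inner (\<lambda>i. k * a i) c = k * ell2_inner a c"
  using sums_mult[OF ell2_inner_sums[of a c], of k]
  by (simp add: ell2_inner_def algebra_simps sums_iff)

lemma ell2_inner_diff_left:
  "a \<in> ell2 \<Longrightarrow> b \<in> ell2 \<Longrightarrow> c \<in> ell2 \<Longrightarrow>
    ell2_inner (\<lambda>i. a i - b i) c = ell2_inner a c - ell2_inner b c"
  using sums_diff[OF ell2_inner_sums[of a c] ell2_inner_sums[of b c]]
  by (simp add: ell2_inner_def algebra_simps sums_iff)

lemma ell2_inner_lincomb_left:
  assumes "\<And>k. k \<in> A \<Longrightarrow> e k \<in> ell2" and "w \<in> ell2"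
  shows "ell2_inner (\<lambda>i. \<Sum>k\<in>A. c k * e k i) w = (\<Sum>k\<in>A. c k * ell2_inner (e k) w)"
  using assms
proof (induction A rule: infinite_finite_induct)
  case (insert x A)
  have "ell2_inner (\<lambda>i. c x * e x i + (\<Sum>k\<in>A. c k * e k i)) w =
      ell2_inner (\<lambda>i. c x * e x i) w + ell2_inner (\<lambda>i. \<Sum>k\<in>A. c k * e k i) w"
    using insert by (intro ell2_inner_add_left ell2_scale ell2_lincomb) auto
  also have "ell2_inner (\<lambda>i. c x * e x i) w = c x * ell2_inner (e x) w"
    using insert by (intro ell2_inner_scale_left) auto
  finally show ?case using insert by simp
qed (simp_all add: ell2_inner_def)

lemma ell2_inner_commute: "a \<in> ell2 \<Longrightarrow> b \<in> ell2 \<Longrightarrow> ell2_inner b a = cnj (ell2_inner a b)"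
  using sums_cnj[THEN iffD2, OF ell2_inner_sums[of a b]]
  by (simp add: ell2_inner_def algebra_simps sums_iff)

lemma ell2_inner_self: "a \<in> ell2 \<Longrightarrow> ell2_inner a a = complex_of_real (sqnorm a)"
  using sums_of_real[OF sqnorm_sums[of a], where 'a = complex]
  by (simp add: ell2_inner_def sums_iff complex_norm_square[symmetric] flip: of_real_power)

lemma sqnorm_add:
  assumes "a \<in> ell2" "b \<in> ell2"
  shows "sqnorm (\<lambda>i. a i + b i) = sqnorm a + 2 * Re (ell2_inner a b) + sqnorm b"
proof -
  have s: "(\<lambda>i. a i + b i) \<in> ell2" using assms by (rule ell2_add)
  have r: "ell2_inner c (\<lambda>i. a i + b i) = ell2_inner c a + ell2_inner c b" if "c \<in> ell2" for c
    using ell2_inner_commute[OF s that] ell2_inner_add_left[OF assms that]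
      ell2_inner_commute[OF assms(1) that] ell2_inner_commute[OF assms(2) that] by simp
  have "complex_of_real (sqnorm (\<lambda>i. a i + b i)) =
      ell2_inner a a + ell2_inner a b + (ell2_inner b a + ell2_inner b b)"
    unfolding ell2_inner_self[OF s, symmetric]
    using ell2_inner_add_left[OF assms s] by (simp add: r assms)
  then show ?thesis
    unfolding ell2_inner_self[OF assms(1)] ell2_inner_self[OF assms(2)]
      ell2_inner_commute[OF assms]
    by (auto simp: complex_eq_iff)
qed

lemma ell2_cauchy_schwarz:
  assumes "a \<in> ell2" "b \<in> ell2"
  shows "cmod (ell2_inner a b) \<le> sqrt (sqnorm a) * sqrt (sqnorm b)"
proof (rule LIMSEQ_le_const2)
  show "(\<lambda>N. cmod (\<Sum>i<N. a i * cnj (b i))) \<longlonglongrightarrow> cmod (ell2_inner a b)"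
    using ell2_inner_sums[OF assms] unfolding sums_def by (rule tendsto_norm)
  have "cmod (\<Sum>i<N. a i * cnj (b i)) \<le> sqrt (sqnorm a) * sqrt (sqnorm b)" for N
  proof -
    have "cmod (\<Sum>i<N. a i * cnj (b i)) \<le> (\<Sum>i<N. cmod (a i) * cmod (b i))"
      by (rule order_trans[OF norm_sum]) (simp add: norm_mult)
    also have "\<dots> \<le> sqrt (\<Sum>i<N. (cmod (a i))\<^sup>2) * sqrt (\<Sum>i<N. (cmod (b i))\<^sup>2)"
      unfolding real_sqrt_mult[symmetric]
      by (intro real_le_rsqrt Cauchy_Schwarz_ineq_sum)
    also have "\<dots> \<le> sqrt (sqnorm a) * sqrt (sqnorm b)"
      using assms by (intro mult_mono real_sqrt_le_mono sum_le_sqnorm) (auto intro: sum_nonneg sqnorm_nonneg)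
    finally show ?thesis .
  qed
  then show "\<exists>N. \<forall>n\<ge>N. cmod (\<Sum>i<n. a i * cnj (b i)) \<le> sqrt (sqnorm a) * sqrt (sqnorm b)" by blast
qed

text \<open>
  Minkowski's inequality; the Weyl inequality for singular values uses it to bound
  \<open>(A + B) w\<close>.
\<close>

lemma sqrt_sqnorm_triangle:
  assumes "a \<in> ell2" "b \<in> ell2"
  shows "sqrt (sqnorm (\<lambda>i. a i + b i)) \<le> sqrt (sqnorm a) + sqrt (sqnorm b)"
proof (rule real_le_lsqrt)
  have "Re (ell2_inner a b) \<le> sqrt (sqnorm a) * sqrt (sqnorm b)"
    using complex_Re_le_cmod ell2_cauchy_schwarz[OF assms] by (rule order_trans)
  then show "sqnorm (\<lambda>i. a i + b i) \<le> (sqrt (sqnorm a) + sqrt (sqnorm b))\<^sup>2"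
    unfolding sqnorm_add[OF assms] using sqnorm_nonneg assms by (simp add: power2_sum)
qed (use assms in \<open>auto intro!: add_nonneg_nonneg sqnorm_nonneg\<close>)

definition std_vec :: "nat \<Rightarrow> nat \<Rightarrow> complex" where
  "std_vec j = (\<lambda>i. if i = j then 1 else 0)"

lemma ell2_finite_support: "finite {i. a i \<noteq> 0} \<Longrightarrow> a \<in> ell2"
  unfolding ell2_def by (auto intro!: summable_finite[of "{i. a i \<noteq> 0}"])

lemma std_vec_ell2: "std_vec j \<in> ell2"
  by (rule ell2_finite_support) (auto simp: std_vec_def)

lemma ell2_inner_std_vec: "ell2_inner a (std_vec j) = a j" "ell2_inner (std_vec j) a = cnj (a j)"
proof -
  have "(\<lambda>i. if i = j then a i else 0) sums a j" "(\<lambda>i. if i = j then cnj (a i) else 0) sums cnj (a j)"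
    by (rule sums_single)+
  moreover have "(\<lambda>i. if i = j then a i else 0) = (\<lambda>i. a i * cnj (std_vec j i))"
    "(\<lambda>i. if i = j then cnj (a i) else 0) = (\<lambda>i. std_vec j i * cnj (a i))"
    by (auto simp: std_vec_def)
  ultimately show "ell2_inner a (std_vec j) = a j" "ell2_inner (std_vec j) a = cnj (a j)"
    by (simp_all add: ell2_inner_def sums_iff)
qed

lemma orthonormal_seq_std_vec: "inj f \<Longrightarrow> orthonormal_seq (\<lambda>n. std_vec (f n))"
  by (auto simp: orthonormal_seq_def std_vec_ell2 ell2_inner_std_vec) (auto simp: std_vec_def inj_eq)

lemma sqnorm_std_vec: "sqnorm (std_vec j) = 1"
  using ell2_inner_self[OF std_vec_ell2, of j] unfolding ell2_inner_std_vec
  by (simp add: std_vec_def complex_eq_iff)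

text \<open>
  Finite families appear below as initial segments of sequences, so orthonormality is relativised
  to an index set and values outside that set are left unconstrained.
\<close>

definition orthonormal_on :: "nat set \<Rightarrow> (nat \<Rightarrow> nat \<Rightarrow> complex) \<Rightarrow> bool" where
  "orthonormal_on A e \<longleftrightarrow> (\<forall>n\<in>A. e n \<in> ell2) \<and>
     (\<forall>m\<in>A. \<forall>n\<in>A. ell2_inner (e m) (e n) = (if m = n then 1 else 0))"

lemma orthonormal_on_seq: "orthonormal_seq e \<Longrightarrow> orthonormal_on A e"
  by (auto simp: orthonormal_on_def orthonormal_seq_def)

lemma orthonormal_seq_cnj: "orthonormal_seq e \<Longrightarrow> orthonormal_seq (\<lambda>n i. cnj (e n i))"
proof -
  assume e: "orthonormal_seq e"
  have "ell2_inner (\<lambda>i. cnj (e m i)) (\<lambda>i. cnj (e n i)) = ell2_inner (e n) (e m)" for m n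
    by (simp add: ell2_inner_def mult.commute)
  then show ?thesis using e by (auto simp: orthonormal_seq_def ell2_cnj)
qed

lemma sqnorm_orthonormal_lincomb:
  assumes "orthonormal_on A e" "finite A"
  shows "sqnorm (\<lambda>i. \<Sum>k\<in>A. c k * e k i) = (\<Sum>k\<in>A. (cmod (c k))\<^sup>2)"
proof -
  let ?y = "\<lambda>i. \<Sum>k\<in>A. c k * e k i"
  have e: "\<And>k. k \<in> A \<Longrightarrow> e k \<in> ell2"
    and o: "\<And>m n. m \<in> A \<Longrightarrow> n \<in> A \<Longrightarrow> ell2_inner (e m) (e n) = (if m = n then 1 else 0)"
    using assms by (auto simp: orthonormal_on_def)
  have y: "?y \<in> ell2" using e by (intro ell2_lincomb)
  have "ell2_inner ?y (e n) = c n" if "n \<in> A" for n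
    using ell2_inner_lincomb_left[of A e "e n" c] e that assms(2) by (simp add: o if_distrib cong: if_cong)
  then have "ell2_inner (e n) ?y = cnj (c n)" if "n \<in> A" for n
    using ell2_inner_commute[OF y e[OF that]] that by simp
  then have "ell2_inner ?y ?y = (\<Sum>k\<in>A. c k * cnj (c k))"
    using ell2_inner_lincomb_left[of A e ?y c] e y by simp
  also have "\<dots> = complex_of_real (\<Sum>k\<in>A. (cmod (c k))\<^sup>2)"
    by (simp add: complex_norm_square del: of_real_power)
  finally show ?thesis
    unfolding ell2_inner_self[OF y] by (simp only: of_real_eq_iff)
qed

text \<open>
  The component of \<open>a\<close> orthogonal to a finite orthonormal family. Besides Bessel's inequality, the
  exact norm of this residual is what controls the remainder of a truncated singular value
  decomposition.
\<close>

lemma orthonormal_residual: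
  assumes "orthonormal_on A e" "finite A" "a \<in> ell2"
  defines "h \<equiv> \<lambda>i. a i - (\<Sum>k\<in>A. ell2_inner a (e k) * e k i)"
  shows "h \<in> ell2" "\<And>n. n \<in> A \<Longrightarrow> ell2_inner h (e n) = 0"
    "sqnorm h = sqnorm a - (\<Sum>k\<in>A. (cmod (ell2_inner a (e k)))\<^sup>2)"
proof -
  let ?y = "\<lambda>i. \<Sum>k\<in>A. ell2_inner a (e k) * e k i"
  have e: "\<And>k. k \<in> A \<Longrightarrow> e k \<in> ell2"
    and o: "\<And>m n. m \<in> A \<Longrightarrow> n \<in> A \<Longrightarrow> ell2_inner (e m) (e n) = (if m = n then 1 else 0)"
    using assms by (auto simp: orthonormal_on_def)
  have y: "?y \<in> ell2" using e by (intro ell2_lincomb)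
  show h: "h \<in> ell2" unfolding h_def by (intro ell2_diff y assms)
  show 0: "ell2_inner h (e n) = 0" if "n \<in> A" for n
    unfolding h_def ell2_inner_diff_left[OF assms(3) y e[OF that]]
    using ell2_inner_lincomb_left[of A e "e n"] e that assms(2) by (simp add: o if_distrib cong: if_cong)
  have "ell2_inner ?y h = (\<Sum>k\<in>A. ell2_inner a (e k) * ell2_inner (e k) h)"
    using e h by (intro ell2_inner_lincomb_left)
  also have "\<dots> = 0"
    using 0 ell2_inner_commute[OF h e] by simp
  finally have "ell2_inner h ?y = 0"
    using ell2_inner_commute[OF y h] by simp
  moreover have "a = (\<lambda>i. h i + ?y i)" by (simp add: h_def)
  ultimately have "sqnorm a = sqnorm h + sqnorm ?y"
    using sqnorm_add[OF h y] by simp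
  then show "sqnorm h = sqnorm a - (\<Sum>k\<in>A. (cmod (ell2_inner a (e k)))\<^sup>2)"
    using sqnorm_orthonormal_lincomb[OF assms(1,2)] by simp
qed

lemma bessel:
  assumes "orthonormal_on A e" "finite A" "a \<in> ell2"
  shows "(\<Sum>k\<in>A. (cmod (ell2_inner a (e k)))\<^sup>2) \<le> sqnorm a"
  using orthonormal_residual(3)[OF assms] sqnorm_nonneg[OF orthonormal_residual(1)[OF assms]] by simp

lemma bessel_seq:
  assumes "orthonormal_seq e" "a \<in> ell2"
  shows "(\<lambda>n. ell2_inner a (e n)) \<in> ell2" "sqnorm (\<lambda>n. ell2_inner a (e n)) \<le> sqnorm a"
  using ell2_bounded[of "\<lambda>n. ell2_inner a (e n)" "sqnorm a"]
    bessel[OF orthonormal_on_seq[OF assms(1)] _ assms(2)] by auto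

text \<open>
  A singular value decomposition is given as an entrywise convergent series, whereas all arguments
  about it need convergence in norm. The bridge is the Riesz--Fischer argument: for square summable
  coefficients the partial sums form a Cauchy sequence, and letting the later partial sum tend
  coordinatewise to \<open>y\<close> bounds the distance from \<open>y\<close> to the earlier one by the tail of \<open>c\<close>.
\<close>

lemma orthonormal_expansion:
  assumes e: "orthonormal_seq e" and c: "c \<in> ell2" and y: "\<And>j. (\<lambda>n. c n * e n j) sums y j"
  shows "y \<in> ell2" and "sqnorm y = sqnorm c"
    and "\<And>w. w \<in> ell2 \<Longrightarrow> (\<lambda>n. c n * ell2_inner (e n) w) sums ell2_inner y w"
proof -
  define P where "P N j = (\<Sum>n<N. c n * e n j)" for N j
  define t where "t N = sqnorm c - (\<Sum>n<N. (cmod (c n))\<^sup>2)" for N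
  have e2: "e n \<in> ell2" for n using e by (simp add: orthonormal_seq_def)
  have P2: "P N \<in> ell2" for N unfolding P_def using e2 by (intro ell2_lincomb)
  have t0: "t \<longlonglongrightarrow> 0"
    using tendsto_diff[OF tendsto_const[of "sqnorm c"] sqnorm_sums[OF c, unfolded sums_def]]
    unfolding t_def by simp
  \<comment> \<open>Fatou's lemma for finitely many coordinates: the bound is uniform in the later partial sum.\<close>
  have "(\<Sum>j<J. (cmod (y j - P N j))\<^sup>2) \<le> t N" for J N
  proof (rule LIMSEQ_le_const2)
    show "(\<lambda>M. \<Sum>j<J. (cmod (P M j - P N j))\<^sup>2) \<longlonglongrightarrow> (\<Sum>j<J. (cmod (y j - P N j))\<^sup>2)"
      using y unfolding P_def sums_def by (intro tendsto_intros)
    have "(\<Sum>j<J. (cmod (P M j - P N j))\<^sup>2) \<le> t N" if "N \<le> M" for M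
    proof -
      have "P M j - P N j = (\<Sum>n\<in>{N..<M}. c n * e n j)" for j
        unfolding P_def lessThan_atLeast0 using that by (simp add: sum_diff_nat_ivl)
      then have eq: "(\<lambda>j. P M j - P N j) = (\<lambda>j. \<Sum>n\<in>{N..<M}. c n * e n j)" by auto
      have "(\<Sum>j<J. (cmod (P M j - P N j))\<^sup>2) \<le> sqnorm (\<lambda>j. P M j - P N j)"
        using ell2_diff[OF P2[of M] P2[of N]] by (rule sum_le_sqnorm) simp
      also have "\<dots> = (\<Sum>n\<in>{N..<M}. (cmod (c n))\<^sup>2)"
        unfolding eq by (rule sqnorm_orthonormal_lincomb) (auto intro: orthonormal_on_seq e)
      also have "\<dots> = (\<Sum>n<M. (cmod (c n))\<^sup>2) - (\<Sum>n<N. (cmod (c n))\<^sup>2)"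
        unfolding lessThan_atLeast0 using that by (simp add: sum_diff_nat_ivl)
      also have "\<dots> \<le> t N"
        unfolding t_def using sum_le_sqnorm[OF c, of "{..<M}"] by simp
      finally show ?thesis .
    qed
    then show "\<exists>M0. \<forall>M\<ge>M0. (\<Sum>j<J. (cmod (P M j - P N j))\<^sup>2) \<le> t N" by blast
  qed
  note diff = ell2_bounded[OF this]
  have "(\<lambda>j. (y j - P 0 j) + P 0 j) \<in> ell2" by (intro ell2_add diff P2)
  then show y2: "y \<in> ell2" by simp
  show inner: "(\<lambda>n. c n * ell2_inner (e n) w) sums ell2_inner y w" if w: "w \<in> ell2" for w
  proof -
    have P: "ell2_inner (P N) w = (\<Sum>n<N. c n * ell2_inner (e n) w)" for N
      unfolding P_def using e2 w by (intro ell2_inner_lincomb_left)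
    have "(\<lambda>N. ell2_inner y w - ell2_inner (P N) w) \<longlonglongrightarrow> 0"
    proof (rule Lim_null_comparison)
      have "cmod (ell2_inner y w - ell2_inner (P N) w) \<le> sqrt (t N) * sqrt (sqnorm w)" for N
      proof -
        have "cmod (ell2_inner (\<lambda>j. y j - P N j) w) \<le> sqrt (sqnorm (\<lambda>j. y j - P N j)) * sqrt (sqnorm w)"
          using diff w by (intro ell2_cauchy_schwarz)
        also have "\<dots> \<le> sqrt (t N) * sqrt (sqnorm w)"
          using diff w by (intro mult_right_mono real_sqrt_le_mono) (auto intro: sqnorm_nonneg)
        finally show ?thesis using ell2_inner_diff_left[OF y2 P2 w] by simp
      qed
      then show "\<forall>\<^sub>F N in sequentially. 
          norm (ell2_inner y w - ell2_inner (P N) w) \<le> sqrt (t N) * sqrt (sqnorm w)" by simp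
      show "(\<lambda>N. sqrt (t N) * sqrt (sqnorm w)) \<longlonglongrightarrow> 0"
        using tendsto_mult_left_zero[OF tendsto_real_sqrt[OF t0, simplified]] .
    qed
    from tendsto_diff[OF tendsto_const[of "ell2_inner y w"] this]
    show ?thesis unfolding sums_def P by simp
  qed
  have ye: "ell2_inner y (e m) = c m" for m
  proof -
    have "(\<lambda>n. c n * ell2_inner (e n) (e m)) = (\<lambda>n. if n = m then c n else 0)"
      using e by (auto simp: orthonormal_seq_def fun_eq_iff)
    with inner[OF e2[of m]] have "(\<lambda>n. if n = m then c n else 0) sums ell2_inner y (e m)" by simp
    with sums_single[of m c] show ?thesis by (rule sums_unique2[symmetric])
  qed
  have "(\<lambda>n. complex_of_real ((cmod (c n))\<^sup>2)) sums complex_of_real (sqnorm y)"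
    using inner[OF y2] ell2_inner_commute[OF y2 e2]
    by (simp add: ell2_inner_self[OF y2] ye complex_norm_square del: of_real_power)
  then have "(\<lambda>n. (cmod (c n))\<^sup>2) sums sqnorm y"
    unfolding sums_of_real_iff .
  then show "sqnorm y = sqnorm c" by (simp add: sqnorm_def sums_iff)
qed

section \<open>Orthogonal complements of finite families\<close>

text \<open>
  Gaussian elimination: a homogeneous linear system with fewer equations than unknowns has a nonzero
  solution. The index sets are arbitrary so that the eliminated unknown can simply be removed.
\<close>

lemma exists_nontrivial_solution:
  fixes M :: "'l \<Rightarrow> 'k \<Rightarrow> 'a::field"
  assumes "finite L" "finite K" "card L < card K"
  shows "\<exists>c. (\<exists>k\<in>K. c k \<noteq> 0) \<and> (\<forall>l\<in>L. (\<Sum>k\<in>K. c k * M l k) = 0)"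
  using assms
proof (induction L arbitrary: K M rule: finite_induct)
  case empty
  then obtain k where "k \<in> K" by fastforce
  then show ?case by (intro exI[of _ "\<lambda>_. 1"]) auto
next
  case (insert l L)
  show ?case
  proof (cases "\<forall>k\<in>K. M l k = 0")
    case True
    have "card L < card K" using insert by simp
    from insert.IH[OF insert.prems(1) this, of M] True show ?thesis by auto
  next
    case False
    then obtain k0 where k0: "k0 \<in> K" "M l k0 \<noteq> 0" by auto
    define K' where "K' = K - {k0}"
    define M' where "M' l' k = M l' k - M l' k0 * M l k / M l k0" for l' k
    have fin: "finite K'" "card L < card K'"
      using insert k0 by (auto simp: K'_def)
    from insert.IH[OF this, of M'] obtain c
      where c: "\<exists>k\<in>K'. c k \<noteq> 0" "\<And>l. l \<in> L \<Longrightarrow> (\<Sum>k\<in>K'. c k * M' l k) = 0" by auto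
    \<comment> \<open>The value of the eliminated unknown that makes the equation \<open>l\<close> hold.\<close>
    define q where "q = - (\<Sum>k\<in>K'. c k * M l k) / M l k0"
    define c' where "c' = c(k0 := q)"
    have K: "K = insert k0 K'" "k0 \<notin> K'" using k0 by (auto simp: K'_def)
    have sum: "(\<Sum>k\<in>K. c' k * M l' k) = q * M l' k0 + (\<Sum>k\<in>K'. c k * M l' k)" for l'
    proof -
      have "(\<Sum>k\<in>K'. c' k * M l' k) = (\<Sum>k\<in>K'. c k * M l' k)"
        by (rule sum.cong) (auto simp: c'_def K'_def)
      then show ?thesis using K fin by (simp add: c'_def)
    qed
    have "(\<Sum>k\<in>K. c' k * M l k) = 0"
      using k0 by (simp add: sum q_def)
    moreover have "(\<Sum>k\<in>K. c' k * M l' k) = 0" if "l' \<in> L" for l'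
    proof -
      have "(\<Sum>k\<in>K'. c k * M' l' k) =
          (\<Sum>k\<in>K'. c k * M l' k - M l' k0 / M l k0 * (c k * M l k))"
        unfolding M'_def by (rule sum.cong) (auto simp: algebra_simps)
      also have "\<dots> = (\<Sum>k\<in>K'. c k * M l' k) - M l' k0 / M l k0 * (\<Sum>k\<in>K'. c k * M l k)"
        unfolding sum_subtractf sum_distrib_left ..
      finally show ?thesis using c(2)[OF that] by (simp add: sum q_def algebra_simps)
    qed
    moreover have "\<exists>k\<in>K. c' k \<noteq> 0"
      using c(1) K by (auto simp: c'_def)
    ultimately show ?thesis by (intro exI[of _ c']) auto
  qed
qed

lemma normalize_ell2:
  assumes "w \<in> ell2" "0 < sqnorm w"
  shows "\<exists>q. sqnorm (\<lambda>i. q * w i) = 1 \<and> (cmod q)\<^sup>2 = 1 / sqnorm w"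
proof -
  have "(cmod (complex_of_real (1 / sqrt (sqnorm w))))\<^sup>2 = 1 / sqnorm w"
    using assms(2) by (simp add: norm_divide power_divide)
  moreover from this have "sqnorm (\<lambda>i. complex_of_real (1 / sqrt (sqnorm w)) * w i) = 1"
    unfolding sqnorm_scale[OF assms(1)] using assms(2) by simp
  ultimately show ?thesis by blast
qed

lemma exists_orthogonal_unit_vector:
  fixes e :: "nat \<Rightarrow> nat \<Rightarrow> complex"
  assumes e: "\<And>k. k < n \<Longrightarrow> e k \<in> ell2"
  shows "\<exists>w\<in>ell2. sqnorm w = 1 \<and> (\<forall>k<n. ell2_inner w (e k) = 0)"
proof -
  have "card {..<n} < card {..n}" by simp
  from exists_nontrivial_solution[OF _ _ this, of "\<lambda>l k. ell2_inner (std_vec k) (e l)"]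
  obtain c where c: "\<exists>k\<in>{..n}. c k \<noteq> 0"
    "\<And>l. l < n \<Longrightarrow> (\<Sum>k\<in>{..n}. c k * ell2_inner (std_vec k) (e l)) = 0" by auto
  define w where "w = (\<lambda>i. \<Sum>k\<in>{..n}. c k * std_vec k i)"
  have w2: "w \<in> ell2" unfolding w_def by (intro ell2_lincomb std_vec_ell2)
  have orth: "ell2_inner w (e l) = 0" if "l < n" for l
    unfolding w_def using ell2_inner_lincomb_left[of "{..n}" std_vec "e l" c] c(2)[OF that] e[OF that]
    by (simp add: std_vec_ell2)
  have "sqnorm w = (\<Sum>k\<in>{..n}. (cmod (c k))\<^sup>2)"
    unfolding w_def using orthonormal_seq_std_vec[of "\<lambda>n. n"]
    by (intro sqnorm_orthonormal_lincomb orthonormal_on_seq) auto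
  also have "\<dots> > 0" using c(1) by (auto intro: sum_pos2)
  finally have pos: "sqnorm w > 0" .
  from normalize_ell2[OF w2 pos] obtain q where q: "sqnorm (\<lambda>i. q * w i) = 1" by blast
  have "(\<lambda>i. q * w i) \<in> ell2" "\<forall>k<n. ell2_inner (\<lambda>i. q * w i) (e k) = 0"
    using w2 orth e by (auto intro!: ell2_scale simp: ell2_inner_scale_left)
  with q show ?thesis by blast
qed

section \<open>Singular value decompositions\<close>

text \<open>
  The action of a matrix on a vector. Writing each coordinate as an inner product with the vector in
  the first, linear, argument makes the linearity lemmas and Bessel's inequality directly applicable.
\<close>

definition mat_app :: "(nat \<Rightarrow> nat \<Rightarrow> complex) \<Rightarrow> (nat \<Rightarrow> complex) \<Rightarrow> nat \<Rightarrow> complex" where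
  "mat_app y w = (\<lambda>i. ell2_inner w (\<lambda>j. cnj (y i j)))"

lemma mat_app_alt: "mat_app y w i = ell2_inner (y i) (\<lambda>j. cnj (w j))"
  by (simp add: mat_app_def ell2_inner_def mult.commute)

definition is_svd ::
  "(nat \<Rightarrow> nat \<Rightarrow> complex) \<Rightarrow> (nat \<Rightarrow> real) \<Rightarrow> (nat \<Rightarrow> nat \<Rightarrow> complex) \<Rightarrow> (nat \<Rightarrow> nat \<Rightarrow> complex) \<Rightarrow> bool"
where
  "is_svd x s u v \<longleftrightarrow> (\<forall>n. 0 \<le> s n) \<and> decseq s \<and> s \<longlonglongrightarrow> 0 \<and>
     orthonormal_seq u \<and> orthonormal_seq v \<and>
     (\<forall>i j. (\<lambda>n. complex_of_real (s n) * u n i * cnj (v n j)) sums x i j)"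

lemma has_singular_values_iff_svd: "has_singular_values x s \<longleftrightarrow> (\<exists>u v. is_svd x s u v)"
  by (auto simp: has_singular_values_def is_svd_def)

lemma svd_nonneg: "is_svd x s u v \<Longrightarrow> 0 \<le> s n"
  by (simp add: is_svd_def)

lemma svd_antimono: "is_svd x s u v \<Longrightarrow> m \<le> n \<Longrightarrow> s n \<le> s m"
  by (simp add: is_svd_def decseqD)

lemma svd_scaled_ell2:
  assumes "is_svd x s u v" "a \<in> ell2"
  shows "(\<lambda>n. complex_of_real (s n) * a n) \<in> ell2"
  using assms(2)
proof (rule ell2_comparison(1))
  show "cmod (complex_of_real (s n) * a n) \<le> s 0 * cmod (a n)" for n
    using svd_antimono[OF assms(1), of 0 n] svd_nonneg[OF assms(1), of n]
    by (auto simp: norm_mult intro!: mult_right_mono)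
qed

text \<open>
  The \<open>i\<close>-th coordinates of an orthonormal sequence are, up to conjugation, the coefficients of
  the \<open>i\<close>-th basis vector, so this is Bessel's inequality.
\<close>

lemma svd_coord_ell2:
  assumes "is_svd x s u v"
  shows "(\<lambda>n. u n i) \<in> ell2" "(\<Sum>n<N. (cmod (u n i))\<^sup>2) \<le> 1"
proof -
  have u: "orthonormal_seq u" using assms by (simp add: is_svd_def)
  show "(\<lambda>n. u n i) \<in> ell2"
    using bessel_seq(1)[OF u std_vec_ell2[of i]] by (simp add: ell2_inner_std_vec ell2_cnj)
  show "(\<Sum>n<N. (cmod (u n i))\<^sup>2) \<le> 1"
    using bessel[OF orthonormal_on_seq[OF u] _ std_vec_ell2[of i], of "{..<N}"]
    by (simp add: ell2_inner_std_vec sqnorm_std_vec)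
qed

text \<open>
  Each row of \<open>x\<close> is an orthonormal expansion in the conjugated right singular vectors, with
  coefficients \<open>s n * u n i\<close>; its norm and its pairing with a vector follow.
\<close>

lemma svd_row:
  assumes "is_svd x s u v"
  shows "x i \<in> ell2" and "sqnorm (x i) = sqnorm (\<lambda>n. complex_of_real (s n) * u n i)"
    and "w \<in> ell2 \<Longrightarrow> (\<lambda>n. complex_of_real (s n) * u n i * ell2_inner w (v n)) sums mat_app x w i"
proof -
  have v: "orthonormal_seq (\<lambda>n j. cnj (v n j))"
    using assms by (auto simp: is_svd_def intro: orthonormal_seq_cnj)
  note c = svd_scaled_ell2[OF assms svd_coord_ell2(1)[OF assms, of i]]
  have "(\<lambda>n. complex_of_real (s n) * u n i * cnj (v n j)) sums x i j" for j
    using assms by (simp add: is_svd_def)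
  note exp = orthonormal_expansion[OF v c this]
  show "x i \<in> ell2" "sqnorm (x i) = sqnorm (\<lambda>n. complex_of_real (s n) * u n i)"
    by (fact exp(1,2))+
  show "(\<lambda>n. complex_of_real (s n) * u n i * ell2_inner w (v n)) sums mat_app x w i" if "w \<in> ell2"
    using exp(3)[of "\<lambda>j. cnj (w j)"] that
    by (simp add: mat_app_alt ell2_cnj) (simp add: ell2_inner_def mult.commute)
qed

lemma svd_mat_app:
  assumes "is_svd x s u v" "w \<in> ell2"
  shows "mat_app x w \<in> ell2" and "sqnorm (mat_app x w) = sqnorm (\<lambda>n. complex_of_real (s n) * ell2_inner w (v n))"
proof -
  have u: "orthonormal_seq u" and v: "orthonormal_seq v" using assms by (auto simp: is_svd_def)
  have "(\<lambda>n. complex_of_real (s n) * ell2_inner w (v n) * u n i) sums mat_app x w i" for i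
    using svd_row(3)[OF assms, of i] by (simp add: algebra_simps)
  from orthonormal_expansion(1,2)[OF u svd_scaled_ell2[OF assms(1) bessel_seq(1)[OF v assms(2)]] this]
  show "mat_app x w \<in> ell2" "sqnorm (mat_app x w) = sqnorm (\<lambda>n. complex_of_real (s n) * ell2_inner w (v n))" .
qed

lemma svd_transpose:
  assumes "is_svd x s u v"
  shows "is_svd (\<lambda>i j. x j i) s (\<lambda>n i. cnj (v n i)) (\<lambda>n i. cnj (u n i))"
  using assms by (auto simp: is_svd_def orthonormal_seq_cnj algebra_simps)

text \<open>
  On the orthogonal complement of the first \<open>m\<close> right singular vectors only the coefficients with
  singular value at most \<open>a m\<close> survive.
\<close>

lemma svd_mat_app_orthogonal_le:
  assumes "is_svd A a u v" "w \<in> ell2" "\<And>k. k < m \<Longrightarrow> ell2_inner w (v k) = 0"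
  shows "sqrt (sqnorm (mat_app A w)) \<le> a m * sqrt (sqnorm w)"
proof -
  have v: "orthonormal_seq v" using assms by (auto simp: is_svd_def)
  note b = bessel_seq[OF v assms(2)]
  have "cmod (complex_of_real (a k) * ell2_inner w (v k)) \<le> a m * cmod (ell2_inner w (v k))" for k
  proof (cases "k < m")
    case False
    then show ?thesis using svd_antimono[OF assms(1), of m k] svd_nonneg[OF assms(1), of k]
      by (auto simp: norm_mult intro!: mult_right_mono)
  qed (simp add: assms)
  then have "sqnorm (mat_app A w) \<le> (a m)\<^sup>2 * sqnorm (\<lambda>k. ell2_inner w (v k))"
    unfolding svd_mat_app(2)[OF assms(1,2)] by (rule ell2_comparison(2)[OF b(1)])
  also have "\<dots> \<le> (a m)\<^sup>2 * sqnorm w"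
    using b(2) by (rule mult_left_mono) simp
  finally have "sqrt (sqnorm (mat_app A w)) \<le> sqrt ((a m)\<^sup>2 * sqnorm w)" by (rule real_sqrt_le_mono)
  then show ?thesis using svd_nonneg[OF assms(1), of m] by (simp add: real_sqrt_mult)
qed

text \<open>
  By counting dimensions, the span of the first \<open>m + n + 1\<close> right singular vectors of \<open>y\<close>
  contains a nonzero \<open>w\<close> orthogonal to the first \<open>m\<close> right singular vectors of \<open>A\<close> and the first
  \<open>n\<close> of \<open>B\<close>. On such a vector \<open>y\<close> expands by at least \<open>t (m + n)\<close>, while \<open>A\<close> and \<open>B\<close> expand by
  at most \<open>a m\<close> and \<open>b n\<close>.

  The inequality is used twice: with \<open>m = n\<close> it replaces the triangle inequality in Schatten
  classes, and with \<open>B = 0\<close> it shows that singular values do not depend on the decomposition.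
\<close>

lemma weyl_singular_value_inequality:
  assumes y: "is_svd y t u v" and A: "is_svd A a u1 v1" and B: "is_svd B b u2 v2"
    and sum: "\<And>i j. y i j = A i j + B i j"
  shows "t (m + n) \<le> a m + b n"
proof -
  have v: "orthonormal_seq v" and v1: "orthonormal_seq v1" and v2: "orthonormal_seq v2"
    using y A B by (auto simp: is_svd_def)
  then have e: "v k \<in> ell2" "v1 k \<in> ell2" "v2 k \<in> ell2" for k by (auto simp: orthonormal_seq_def)
  define M where "M l k = (if l < m then ell2_inner (v k) (v1 l) else ell2_inner (v k) (v2 (l - m)))" for l k
  have "card {..<m+n} < card {..m+n}" by simp
  from exists_nontrivial_solution[OF _ _ this, of M] obtain c
    where c: "\<exists>k\<in>{..m+n}. c k \<noteq> 0" "\<And>l. l < m + n \<Longrightarrow> (\<Sum>k\<in>{..m+n}. c k * M l k) = 0" by auto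
  define w where "w = (\<lambda>i. \<Sum>k\<in>{..m+n}. c k * v k i)"
  have w: "w \<in> ell2" unfolding w_def using e by (intro ell2_lincomb)
  have inner: "ell2_inner w z = (\<Sum>k\<in>{..m+n}. c k * ell2_inner (v k) z)" if "z \<in> ell2" for z
    unfolding w_def using e that by (intro ell2_inner_lincomb_left)
  have S: "sqnorm w = (\<Sum>k\<in>{..m+n}. (cmod (c k))\<^sup>2)"
    unfolding w_def using v by (intro sqnorm_orthonormal_lincomb orthonormal_on_seq) auto
  also have "\<dots> > 0" using c(1) by (auto intro: sum_pos2)
  finally have pos: "sqnorm w > 0" .
  have wv: "ell2_inner w (v k) = c k" if "k \<le> m + n" for k
  proof -
    have "ell2_inner w (v k) = (\<Sum>l\<in>{..m+n}. if l = k then c l else 0)"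
      unfolding inner[OF e(1)] using v by (intro sum.cong) (auto simp: orthonormal_seq_def)
    then show ?thesis using that by simp
  qed
  have "ell2_inner w (v1 k) = 0" if "k < m" for k
    using c(2)[of k] that unfolding inner[OF e(2)] M_def by simp
  from svd_mat_app_orthogonal_le[OF A w this]
  have Aw: "sqrt (sqnorm (mat_app A w)) \<le> a m * sqrt (sqnorm w)" by simp
  have "ell2_inner w (v2 k) = 0" if "k < n" for k
    using c(2)[of "m + k"] that unfolding inner[OF e(3)] M_def by simp
  from svd_mat_app_orthogonal_le[OF B w this]
  have Bw: "sqrt (sqnorm (mat_app B w)) \<le> b n * sqrt (sqnorm w)" by simp
  have "(t (m+n))\<^sup>2 * sqnorm w = (\<Sum>k\<in>{..m+n}. (t (m+n))\<^sup>2 * (cmod (c k))\<^sup>2)"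
    unfolding S by (simp add: sum_distrib_left)
  also have "\<dots> \<le> (\<Sum>k\<in>{..m+n}. (cmod (complex_of_real (t k) * ell2_inner w (v k)))\<^sup>2)"
    using svd_antimono[OF y] svd_nonneg[OF y]
    by (intro sum_mono) (auto simp: wv norm_mult power_mult_distrib intro!: mult_right_mono power_mono)
  also have "\<dots> \<le> sqnorm (mat_app y w)"
    unfolding svd_mat_app(2)[OF y w]
    by (intro sum_le_sqnorm svd_scaled_ell2[OF y] bessel_seq(1)[OF v w]) auto
  finally have "sqrt ((t (m+n))\<^sup>2 * sqnorm w) \<le> sqrt (sqnorm (mat_app y w))" by (rule real_sqrt_le_mono)
  then have "t (m+n) * sqrt (sqnorm w) \<le> sqrt (sqnorm (mat_app y w))"
    using svd_nonneg[OF y] by (simp add: real_sqrt_mult)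
  also have "mat_app y w = (\<lambda>i. mat_app A w i + mat_app B w i)"
  proof
    fix i
    have "y i = (\<lambda>j. A i j + B i j)" using sum by auto
    then show "mat_app y w i = mat_app A w i + mat_app B w i"
      unfolding mat_app_alt
      using ell2_inner_add_left[OF svd_row(1)[OF A] svd_row(1)[OF B]] w by (simp add: ell2_cnj)
  qed
  also have "sqrt (sqnorm \<dots>) \<le> sqrt (sqnorm (mat_app A w)) + sqrt (sqnorm (mat_app B w))"
    by (intro sqrt_sqnorm_triangle svd_mat_app(1)[OF A w] svd_mat_app(1)[OF B w])
  also have "\<dots> \<le> (a m + b n) * sqrt (sqnorm w)"
    using Aw Bw by (simp add: algebra_simps)
  finally show ?thesis using pos by simp
qed

text \<open>
  A matrix with decreasing entries along a partial permutation already displays its singular values.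
  The hypothesis that \<open>s\<close> decreases spares a rearrangement; the test matrices below are built so
  that it holds.
\<close>

lemma svd_generalized_permutation:
  assumes "inj f" "inj g" "\<And>n. 0 \<le> s n" "decseq s" "s \<longlonglongrightarrow> 0"
  shows "is_svd (\<lambda>i j. if \<exists>n. i = f n \<and> j = g n then complex_of_real (s (inv f i)) else 0) s
           (\<lambda>n. std_vec (f n)) (\<lambda>n. std_vec (g n))"
proof -
  have "(\<lambda>n. complex_of_real (s n) * std_vec (f n) i * cnj (std_vec (g n) j)) sums
      (if \<exists>n. i = f n \<and> j = g n then complex_of_real (s (inv f i)) else 0)" for i j
  proof (cases "\<exists>n. i = f n \<and> j = g n")
    case True
    then obtain n0 where n0: "i = f n0" "j = g n0" by auto
    have "(\<lambda>n. complex_of_real (s n) * std_vec (f n) i * cnj (std_vec (g n) j)) =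
        (\<lambda>n. if n = n0 then complex_of_real (s n) else 0)"
      using assms(1,2) by (auto simp: n0 std_vec_def inj_eq)
    with sums_single[of n0 "\<lambda>n. complex_of_real (s n)"] True show ?thesis
      using assms(1) by (simp add: n0)
  next
    case False
    then have "(\<lambda>n. complex_of_real (s n) * std_vec (f n) i * cnj (std_vec (g n) j)) = (\<lambda>n. 0)"
      by (auto simp: std_vec_def fun_eq_iff)
    then show ?thesis unfolding if_not_P[OF False] by simp
  qed
  then show ?thesis
    using assms by (simp add: is_svd_def orthonormal_seq_std_vec)
qed

lemma svd_zero: "is_svd (\<lambda>i j. 0) (\<lambda>n. 0) std_vec std_vec"
  using orthonormal_seq_std_vec[of "\<lambda>n. n"] by (simp add: is_svd_def decseq_def)

lemma singular_values_unique:
  assumes "has_singular_values x s" "has_singular_values x t"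
  shows "s = t"
proof -
  have "s n \<le> t n" if s: "is_svd x s u v" and t: "is_svd x t u' v'" for s t u v u' v' n
    using weyl_singular_value_inequality[OF s t svd_zero, of n 0] by simp
  then show ?thesis
    using assms by (intro ext antisym) (auto simp: has_singular_values_iff_svd)
qed

lemma singular_values_eq: "has_singular_values x s \<Longrightarrow> singular_values x = s"
  unfolding singular_values_def by (rule some_equality) (auto dest: singular_values_unique)

section \<open>Existence of decompositions for Hilbert--Schmidt matrices\<close>

text \<open>
  Summability of the rows in norm is the iterated form of square summability of all entries.
\<close>

definition hilbert_schmidt :: "(nat \<Rightarrow> nat \<Rightarrow> complex) \<Rightarrow> bool" where
  "hilbert_schmidt y \<longleftrightarrow> (\<forall>i. y i \<in> ell2) \<and> summable (\<lambda>i. sqnorm (y i))"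

lemma mat_app_bound:
  assumes "y i \<in> ell2" "w \<in> ell2"
  shows "(cmod (mat_app y w i))\<^sup>2 \<le> sqnorm (y i) * sqnorm w"
proof -
  have "cmod (mat_app y w i) \<le> sqrt (sqnorm (y i)) * sqrt (sqnorm w)"
    using ell2_cauchy_schwarz[OF assms(1), of "\<lambda>j. cnj (w j)"] assms(2)
    by (simp add: mat_app_alt ell2_cnj sqnorm_cnj)
  from power_mono[OF this, of 2] show ?thesis
    using assms by (simp add: power_mult_distrib sqnorm_nonneg)
qed

lemma mat_app_ell2:
  assumes "hilbert_schmidt y" "w \<in> ell2"
  shows "mat_app y w \<in> ell2"
proof -
  have "summable (\<lambda>i. sqnorm (y i) * sqnorm w)"
    using assms by (auto simp: hilbert_schmidt_def intro: summable_mult2)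
  moreover have "norm ((cmod (mat_app y w i))\<^sup>2) \<le> sqnorm (y i) * sqnorm w" for i
    using mat_app_bound[of y i w] assms by (simp add: hilbert_schmidt_def)
  ultimately show ?thesis unfolding ell2_def by (auto intro: summable_comparison_test'[where N = 0])
qed

lemma mat_app_add:
  assumes "\<And>i. y i \<in> ell2" "a \<in> ell2" "b \<in> ell2"
  shows "mat_app y (\<lambda>j. a j + b j) = (\<lambda>i. mat_app y a i + mat_app y b i)"
  using assms by (auto simp: mat_app_def ell2_inner_add_left ell2_cnj)

lemma mat_app_scale:
  assumes "\<And>i. y i \<in> ell2" "a \<in> ell2"
  shows "mat_app y (\<lambda>j. k * a j) = (\<lambda>i. k * mat_app y a i)"
  using assms by (auto simp: mat_app_def ell2_inner_scale_left ell2_cnj)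

text \<open>
  The constraint is stated on partial sums because each of them depends on finitely many coordinates,
  which makes the ball visibly closed for coordinatewise convergence.
\<close>

definition unit_ball :: "(nat \<Rightarrow> complex) set" where
  "unit_ball = {w. \<forall>N. (\<Sum>i<N. (cmod (w i))\<^sup>2) \<le> 1}"

lemma unit_ball_iff: "w \<in> unit_ball \<longleftrightarrow> w \<in> ell2 \<and> sqnorm w \<le> 1"
proof
  assume "w \<in> unit_ball"
  then show "w \<in> ell2 \<and> sqnorm w \<le> 1" using ell2_bounded[of w 1] by (simp add: unit_ball_def)
next
  assume w: "w \<in> ell2 \<and> sqnorm w \<le> 1"
  then have "(\<Sum>i<N. (cmod (w i))\<^sup>2) \<le> 1" for N
    using sum_le_sqnorm[of w "{..<N}"] by simp
  then show "w \<in> unit_ball" by (simp add: unit_ball_def)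
qed

text \<open>
  Compactness of the ball in the weak topology, obtained here from Tychonoff's theorem: the ball is a
  closed subset of a product of discs, with the product topology of the function type.
\<close>

lemma compact_unit_ball: "compact unit_ball"
proof -
  have "compactin (product_topology (\<lambda>i. euclidean) UNIV) (PiE UNIV (\<lambda>i::nat. cball (0::complex) 1))"
    by (simp add: compactin_PiE)
  then have "compact (PiE UNIV (\<lambda>i::nat. cball (0::complex) 1))"
    by (simp add: euclidean_product_topology)
  moreover have "closed unit_ball"
    unfolding unit_ball_def
    by (intro closed_Collect_all closed_Collect_le continuous_intros continuous_on_product_coordinates)
  moreover have "unit_ball \<subseteq> PiE UNIV (\<lambda>i::nat. cball (0::complex) 1)"
  proof
    fix w assume w: "w \<in> unit_ball"
    have "cmod (w i) \<le> 1" for i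
    proof -
      have "(cmod (w i))\<^sup>2 \<le> 1"
        using w coord_le_sqnorm[of w i] by (simp add: unit_ball_iff)
      then show ?thesis using power2_le_imp_le[of "cmod (w i)" 1] by simp
    qed
    then show "w \<in> PiE UNIV (\<lambda>i::nat. cball (0::complex) 1)" by auto
  qed
  ultimately show ?thesis by (metis compact_Int_closed inf.absorb_iff2)
qed

text \<open>
  By Cauchy--Schwarz the series converges uniformly on the ball, since its tail is bounded by the tail
  of \<open>a\<close>.
\<close>

lemma continuous_on_unit_ball_inner:
  assumes a: "a \<in> ell2"
  shows "continuous_on unit_ball (\<lambda>w. ell2_inner w a)"
proof (rule uniform_limit_theorem[where F = sequentially])
  define t where "t N = sqnorm a - (\<Sum>n<N. (cmod (a n))\<^sup>2)" for N
  have t0: "(\<lambda>N. sqrt (t N)) \<longlonglongrightarrow> 0"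
    using tendsto_real_sqrt[OF tendsto_diff[OF tendsto_const[of "sqnorm a"] sqnorm_sums[OF a, unfolded sums_def]]]
    unfolding t_def by simp
  have le: "cmod ((\<Sum>i<N. w i * cnj (a i)) - ell2_inner w a) \<le> sqrt (t N)" if w: "w \<in> unit_ball" for w N
  proof -
    define b where "b = (\<lambda>i. if i < N then 0 else a i)"
    have b2: "b \<in> ell2"
      using a by (rule ell2_comparison(1)[where K = 1]) (auto simp: b_def)
    have w2: "w \<in> ell2" "sqnorm w \<le> 1" using w by (auto simp: unit_ball_iff)
    have "(\<lambda>i. (cmod (a i))\<^sup>2 - (if i \<in> {..<N} then (cmod (a i))\<^sup>2 else 0)) sums t N"
      unfolding t_def by (intro sums_diff sqnorm_sums a sums_If_finite_set) auto
    moreover have "(cmod (a i))\<^sup>2 - (if i \<in> {..<N} then (cmod (a i))\<^sup>2 else 0) = (cmod (b i))\<^sup>2" for i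
      by (auto simp: b_def)
    ultimately have tb: "sqnorm b = t N" by (simp add: sqnorm_def sums_iff)
    have "(\<lambda>i. w i * cnj (a i) - (if i \<in> {..<N} then w i * cnj (a i) else 0)) sums
        (ell2_inner w a - (\<Sum>i<N. w i * cnj (a i)))"
      by (intro sums_diff ell2_inner_sums a w2 sums_If_finite_set) auto
    moreover have "w i * cnj (a i) - (if i \<in> {..<N} then w i * cnj (a i) else 0) = w i * cnj (b i)" for i
      by (auto simp: b_def)
    ultimately have "ell2_inner w b = ell2_inner w a - (\<Sum>i<N. w i * cnj (a i))"
      by (simp add: ell2_inner_def sums_iff)
    then have "cmod ((\<Sum>i<N. w i * cnj (a i)) - ell2_inner w a) \<le> sqrt (sqnorm w) * sqrt (sqnorm b)"
      using ell2_cauchy_schwarz[OF w2(1) b2] by (simp add: norm_minus_commute)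
    also have "\<dots> \<le> 1 * sqrt (sqnorm b)"
      using w2 b2 by (intro mult_right_mono) (auto intro: sqnorm_nonneg)
    finally show ?thesis by (simp add: tb)
  qed
  show "uniform_limit unit_ball (\<lambda>N w. \<Sum>i<N. w i * cnj (a i)) (\<lambda>w. ell2_inner w a) sequentially"
  proof (rule uniform_limitI)
    fix e :: real assume "e > 0"
    then have "\<forall>\<^sub>F N in sequentially. sqrt (t N) < e" using t0 by (rule order_tendstoD(2)[rotated])
    then show "\<forall>\<^sub>F N in sequentially. \<forall>w\<in>unit_ball. dist (\<Sum>i<N. w i * cnj (a i)) (ell2_inner w a) < e"
    proof eventually_elim
      case (elim N)
      show ?case unfolding dist_norm using le_less_trans[OF le elim] by blast
    qed
  qed
  show "\<forall>\<^sub>F N in sequentially. continuous_on unit_ball (\<lambda>w. \<Sum>i<N. w i * cnj (a i))"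
    by (intro always_eventually allI continuous_intros continuous_on_subset[OF continuous_on_product_coordinates]) auto
qed simp

text \<open>
  A Hilbert--Schmidt matrix maps weakly convergent sequences in the ball to norm convergent ones: the
  series of the squared coordinates is dominated by the summable squared row norms.
\<close>

lemma continuous_on_unit_ball_mat_app:
  assumes y: "hilbert_schmidt y"
  shows "continuous_on unit_ball (\<lambda>w. sqnorm (mat_app y w))"
proof (rule uniform_limit_theorem[where F = sequentially])
  have y2: "y i \<in> ell2" for i using y by (simp add: hilbert_schmidt_def)
  have "norm ((cmod (mat_app y w i))\<^sup>2) \<le> sqnorm (y i)" if "w \<in> unit_ball" for w i
  proof -
    have "(cmod (mat_app y w i))\<^sup>2 \<le> sqnorm (y i) * sqnorm w"
      using that y2 by (intro mat_app_bound) (auto simp: unit_ball_iff)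
    also have "\<dots> \<le> sqnorm (y i) * 1"
      using that y2 by (intro mult_left_mono) (auto simp: unit_ball_iff sqnorm_nonneg)
    finally show ?thesis by simp
  qed
  moreover have "summable (\<lambda>i. sqnorm (y i))" using y by (simp add: hilbert_schmidt_def)
  ultimately show "uniform_limit unit_ball (\<lambda>N w. \<Sum>i<N. (cmod (mat_app y w i))\<^sup>2)
      (\<lambda>w. sqnorm (mat_app y w)) sequentially"
    unfolding sqnorm_def[of "mat_app y _"] by (rule Weierstrass_m_test)
  have "continuous_on unit_ball (\<lambda>w. mat_app y w i)" for i
    unfolding mat_app_def using y2 by (intro continuous_on_unit_ball_inner) (simp add: ell2_cnj)
  then show "\<forall>\<^sub>F N in sequentially. continuous_on unit_ball (\<lambda>w. \<Sum>i<N. (cmod (mat_app y w i))\<^sup>2)"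
    by (intro always_eventually allI continuous_intros)
qed simp

text \<open>
  A maximiser of \<open>\<parallel>y w\<parallel>\<close> over the ball intersected with an orthogonal complement exists by
  compactness. It can be rescaled to norm 1 unless \<open>y\<close> vanishes on the complement, in which case any
  unit vector of the complement is a maximiser.
\<close>

lemma norm_attained:
  fixes v :: "nat \<Rightarrow> nat \<Rightarrow> complex"
  assumes y: "hilbert_schmidt y" and v: "\<And>k. k < n \<Longrightarrow> v k \<in> ell2"
  shows "\<exists>w\<in>ell2. sqnorm w = 1 \<and> (\<forall>k<n. ell2_inner w (v k) = 0) \<and>
    (\<forall>h\<in>ell2. (\<forall>k<n. ell2_inner h (v k) = 0) \<longrightarrow>
       sqnorm (mat_app y h) \<le> sqnorm (mat_app y w) * sqnorm h)"
proof -
  have y2: "y i \<in> ell2" for i using y by (simp add: hilbert_schmidt_def)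
  define K where "K = {w \<in> unit_ball. (\<Sum>k<n. (cmod (ell2_inner w (v k)))\<^sup>2) = 0}"
  have K: "w \<in> K \<longleftrightarrow> w \<in> ell2 \<and> sqnorm w \<le> 1 \<and> (\<forall>k<n. ell2_inner w (v k) = 0)" for w
    by (auto simp: K_def unit_ball_iff sum_nonneg_eq_0_iff)
  have "compact K"
    unfolding K_def using v
    by (intro closedin_compact[OF compact_unit_ball] continuous_closedin_preimage_constant
        continuous_intros continuous_on_unit_ball_inner) auto
  moreover obtain z where z: "z \<in> ell2" "sqnorm z = 1" "\<forall>k<n. ell2_inner z (v k) = 0"
    using exists_orthogonal_unit_vector[of n v] v by blast
  then have "z \<in> K" by (simp add: K)
  moreover have "continuous_on K (\<lambda>w. sqnorm (mat_app y w))"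
    using continuous_on_unit_ball_mat_app[OF y] by (rule continuous_on_subset) (auto simp: K_def)
  ultimately obtain w0 where w0: "w0 \<in> K" "\<And>h. h \<in> K \<Longrightarrow> sqnorm (mat_app y h) \<le> sqnorm (mat_app y w0)"
    using continuous_attains_sup[of K "\<lambda>w. sqnorm (mat_app y w)"] by blast
  have scale: "(\<lambda>i. q * h i) \<in> ell2" "sqnorm (mat_app y (\<lambda>i. q * h i)) = (cmod q)\<^sup>2 * sqnorm (mat_app y h)"
    "\<forall>k<n. ell2_inner h (v k) = 0 \<Longrightarrow> \<forall>k<n. ell2_inner (\<lambda>i. q * h i) (v k) = 0"
    if "h \<in> ell2" for q h
    using that v
    by (auto simp: mat_app_scale[OF y2 that] sqnorm_scale[OF mat_app_ell2[OF y that]] ell2_scale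
        ell2_inner_scale_left)
  have hom: "sqnorm (mat_app y h) \<le> sqnorm (mat_app y w0) * sqnorm h"
    if h: "h \<in> ell2" "\<forall>k<n. ell2_inner h (v k) = 0" for h
  proof (cases "sqnorm h = 0")
    case True
    then have "(cmod (mat_app y h i))\<^sup>2 \<le> 0" for i using mat_app_bound[of y i h] y2 h(1) by simp
    then show ?thesis using True by (simp add: sqnorm_def)
  next
    case False
    then have pos: "sqnorm h > 0" using sqnorm_nonneg[OF h(1)] by simp
    from normalize_ell2[OF h(1) this] obtain q
      where q: "sqnorm (\<lambda>i. q * h i) = 1" "(cmod q)\<^sup>2 = 1 / sqnorm h" by blast
    have "(\<lambda>i. q * h i) \<in> K" using scale[OF h(1)] h(2) q(1) by (simp add: K)
    from w0(2)[OF this] show ?thesis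
      using pos by (simp add: scale[OF h(1)] q(2) field_simps)
  qed
  show ?thesis
  proof (cases "sqnorm (mat_app y w0) = 0")
    case True
    have "sqnorm (mat_app y h) \<le> sqnorm (mat_app y z) * sqnorm h"
      if "h \<in> ell2" "\<forall>k<n. ell2_inner h (v k) = 0" for h
      using hom[OF that] True mult_nonneg_nonneg[OF sqnorm_nonneg[OF mat_app_ell2[OF y z(1)]] sqnorm_nonneg[OF that(1)]]
      by simp
    with z show ?thesis by blast
  next
    case False
    have w0K: "w0 \<in> ell2" "sqnorm w0 \<le> 1" "\<forall>k<n. ell2_inner w0 (v k) = 0" using w0(1) by (auto simp: K)
    have "0 < sqnorm (mat_app y w0)" using False sqnorm_nonneg[OF mat_app_ell2[OF y w0K(1)]] by simp
    moreover have "sqnorm w0 \<noteq> 0" using hom[OF w0K(1,3)] calculation by auto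
    ultimately have pos: "0 < sqnorm (mat_app y w0)" "0 < sqnorm w0"
      using sqnorm_nonneg[OF w0K(1)] by auto
    from normalize_ell2[OF w0K(1) pos(2)] obtain q
      where q: "sqnorm (\<lambda>i. q * w0 i) = 1" "(cmod q)\<^sup>2 = 1 / sqnorm w0" by blast
    have "sqnorm (mat_app y w0) \<le> sqnorm (mat_app y (\<lambda>i. q * w0 i))"
      using pos w0K(2) by (simp add: scale[OF w0K(1)] q(2) field_simps)
    then have "sqnorm (mat_app y h) \<le> sqnorm (mat_app y (\<lambda>i. q * w0 i)) * sqnorm h"
      if "h \<in> ell2" "\<forall>k<n. ell2_inner h (v k) = 0" for h
      using hom[OF that] sqnorm_nonneg[OF that(1)] by (meson mult_right_mono order_trans)
    then show ?thesis
      using q(1) scale(1)[OF w0K(1)] scale(3)[OF w0K(1,3)] by blast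
  qed
qed

lemma orthonormal_seqI:
  assumes "\<And>n. e n \<in> ell2" "\<And>n. sqnorm (e n) = 1" "\<And>m n. m < n \<Longrightarrow> ell2_inner (e n) (e m) = 0"
  shows "orthonormal_seq e"
proof -
  have "ell2_inner (e m) (e n) = (if m = n then 1 else 0)" for m n
    using assms(3)[of m n] assms(3)[of n m] ell2_inner_self[OF assms(1), of n]
      ell2_inner_commute[OF assms(1) assms(1), of n m]
    by (cases m n rule: linorder_cases) (auto simp: assms(2))
  then show ?thesis using assms(1) by (simp add: orthonormal_seq_def)
qed

text \<open>
  The right singular vectors \<open>v n\<close> are chosen greedily: \<open>v n\<close> maximises \<open>\<parallel>y w\<parallel>\<close> among the unit
  vectors orthogonal to the previous ones, and \<open>s n\<close> is the maximum. A first order variation at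
  \<open>v m\<close> in the direction \<open>v n\<close>, for \<open>m < n\<close>, shows that \<open>y (v m)\<close> and \<open>y (v n)\<close> are orthogonal,
  so after normalisation they are left singular vectors. Bessel's inequality in each row gives
  \<open>s \<longlonglongrightarrow> 0\<close>. The remainder of the truncated expansion at the entry \<open>(i, j)\<close> is the
  coordinate \<open>i\<close> of \<open>y\<close> applied to the component of the basis vector \<open>j\<close> orthogonal to
  \<open>v 0, \<dots>, v (N - 1)\<close>, and by maximality this is at most \<open>s N\<close>.
\<close>

lemma hilbert_schmidt_svd_exists:
  assumes y: "hilbert_schmidt y"
  shows "\<exists>s u v. is_svd y s u v"
proof -
  have y2: "y i \<in> ell2" for i using y by (simp add: hilbert_schmidt_def)
  define P where "P v n w \<longleftrightarrow> w \<in> ell2 \<and> sqnorm w = 1 \<and> (\<forall>k<n. ell2_inner w (v k) = 0) \<and>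
    (\<forall>h\<in>ell2. (\<forall>k<n. ell2_inner h (v k) = 0) \<longrightarrow>
       sqnorm (mat_app y h) \<le> sqnorm (mat_app y w) * sqnorm h)"
    for v :: "nat \<Rightarrow> nat \<Rightarrow> complex" and n w
  have "\<exists>v. \<forall>n. P v n (v n)"
  proof (rule dependent_wellorder_choice)
    show "P f n w = P g n w" if "\<And>k. k < n \<Longrightarrow> f k = g k" for f g n w
      using that by (simp add: P_def)
    show "\<exists>w. P f n w" if "\<And>k. k < n \<Longrightarrow> P f k (f k)" for f n
      using norm_attained[OF y, of n f] that unfolding P_def by blast
  qed
  then obtain v where v: "\<And>n. P v n (v n)" by blast
  have v2: "v n \<in> ell2" and v1: "sqnorm (v n) = 1" and vo: "m < n \<Longrightarrow> ell2_inner (v n) (v m) = 0"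
    and vmax: "h \<in> ell2 \<Longrightarrow> (\<And>k. k < n \<Longrightarrow> ell2_inner h (v k) = 0) \<Longrightarrow>
       sqnorm (mat_app y h) \<le> sqnorm (mat_app y (v n)) * sqnorm h" for m n h
    using v[of n] by (auto simp: P_def)
  have vs: "orthonormal_seq v" using v2 v1 vo by (rule orthonormal_seqI)
  define z where "z n = mat_app y (v n)" for n
  have z2: "z n \<in> ell2" for n unfolding z_def by (rule mat_app_ell2[OF y v2])
  define s where "s n = sqrt (sqnorm (z n))" for n
  have s0: "0 \<le> s n" and ss: "(s n)\<^sup>2 = sqnorm (z n)" for n
    using sqnorm_nonneg[OF z2] by (auto simp: s_def)
  have dec: "decseq s"
    unfolding decseq_def s_def
  proof (intro allI impI real_sqrt_le_mono)
    fix m n :: nat assume "m \<le> n"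
    then have "ell2_inner (v n) (v k) = 0" if "k < m" for k using vo[of k n] that by simp
    from vmax[OF v2 this] show "sqnorm (z n) \<le> sqnorm (z m)" by (simp add: v1 z_def)
  qed
  have "(\<Sum>n<N. (s n)\<^sup>2) \<le> (\<Sum>i. sqnorm (y i))" for N
  proof (rule sums_le)
    show "(\<lambda>i. \<Sum>n<N. (cmod (z n i))\<^sup>2) sums (\<Sum>n<N. (s n)\<^sup>2)"
      unfolding ss by (intro sums_sum sqnorm_sums z2)
    show "(\<lambda>i. sqnorm (y i)) sums (\<Sum>i. sqnorm (y i))"
      using y by (simp add: hilbert_schmidt_def summable_sums)
    show "(\<Sum>n<N. (cmod (z n i))\<^sup>2) \<le> sqnorm (y i)" for i
      unfolding z_def mat_app_alt
      by (rule bessel[OF orthonormal_on_seq[OF orthonormal_seq_cnj[OF vs]] _ y2]) simp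
  qed
  then have "summable (\<lambda>n. (s n)\<^sup>2)"
    by (intro summableI_nonneg_bounded) auto
  then have "(\<lambda>n. sqrt ((s n)\<^sup>2)) \<longlonglongrightarrow> sqrt 0"
    by (intro tendsto_real_sqrt summable_LIMSEQ_zero)
  then have lim: "s \<longlonglongrightarrow> 0" using s0 by simp
  have zo: "ell2_inner (z n) (z m) = 0" if mn: "m < n" for m n
  proof -
    define \<alpha> where "\<alpha> = ell2_inner (z m) (z n)"
    \<comment> \<open>The phase of the perturbation is aligned with the inner product, and its size is so small that the
      linear gain would beat the quadratic loss, which is at most \<open>(s m)\<^sup>2 * \<epsilon>\<^sup>2 * (cmod \<alpha>)\<^sup>2\<close>.\<close>
    define \<epsilon> where "\<epsilon> = 1 / ((s m)\<^sup>2 + 1)"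
    define \<gamma> where "\<gamma> = complex_of_real \<epsilon> * \<alpha>"
    have pos: "0 < \<epsilon>" unfolding \<epsilon>_def by (simp add: add_nonneg_pos)
    define h where "h = (\<lambda>j. v m j + \<gamma> * v n j)"
    note g2 = ell2_scale[OF v2[of n], of \<gamma>] and gz2 = ell2_scale[OF z2[of n], of \<gamma>]
    have h2: "h \<in> ell2" unfolding h_def by (intro ell2_add v2 g2)
    have "ell2_inner h (v k) = 0" if "k < m" for k
      unfolding h_def using ell2_inner_add_left[OF v2 g2 v2] ell2_inner_scale_left[OF v2 v2] vo[of k m] vo[of k n] mn that
      by simp
    from vmax[OF h2 this] have le: "sqnorm (mat_app y h) \<le> (s m)\<^sup>2 * sqnorm h" by (simp add: ss z_def)
    have inner_scale: "ell2_inner a (\<lambda>j. \<gamma> * b j) = cnj \<gamma> * ell2_inner a b" if "a \<in> ell2" "b \<in> ell2" for a b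
      using ell2_inner_commute[OF ell2_scale[OF that(2), of \<gamma>] that(1)]
        ell2_inner_scale_left[OF that(2,1), of \<gamma>] ell2_inner_commute[OF that(2,1)] by simp
    have "ell2_inner (v m) (v n) = 0" using ell2_inner_commute[OF v2 v2, of n m] vo[OF mn] by simp
    then have "sqnorm h = 1 + (cmod \<gamma>)\<^sup>2"
      unfolding h_def sqnorm_add[OF v2 g2] by (simp add: v1 sqnorm_scale v2 inner_scale)
    moreover have "mat_app y h = (\<lambda>i. z m i + \<gamma> * z n i)"
      unfolding h_def mat_app_add[OF y2 v2 g2] mat_app_scale[OF y2 v2] z_def ..
    then have "sqnorm (mat_app y h) = (s m)\<^sup>2 + 2 * Re (cnj \<gamma> * \<alpha>) + (cmod \<gamma>)\<^sup>2 * (s n)\<^sup>2"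
      using sqnorm_add[OF z2 gz2, of m] by (simp add: sqnorm_scale z2 inner_scale ss \<alpha>_def)
    moreover have "Re (cnj \<gamma> * \<alpha>) = \<epsilon> * (cmod \<alpha>)\<^sup>2"
      unfolding \<gamma>_def cmod_power2 by (simp add: power2_eq_square algebra_simps)
    moreover have "(cmod \<gamma>)\<^sup>2 = \<epsilon>\<^sup>2 * (cmod \<alpha>)\<^sup>2"
      unfolding \<gamma>_def by (simp add: norm_mult power_mult_distrib)
    ultimately have "2 * \<epsilon> * (cmod \<alpha>)\<^sup>2 + \<epsilon>\<^sup>2 * (cmod \<alpha>)\<^sup>2 * (s n)\<^sup>2 \<le> (s m)\<^sup>2 * (\<epsilon>\<^sup>2 * (cmod \<alpha>)\<^sup>2)"
      using le by (simp add: algebra_simps)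
    moreover have "0 \<le> \<epsilon>\<^sup>2 * (cmod \<alpha>)\<^sup>2 * (s n)\<^sup>2" by simp
    ultimately have "\<epsilon> * (2 * (cmod \<alpha>)\<^sup>2) \<le> \<epsilon> * ((s m)\<^sup>2 * \<epsilon> * (cmod \<alpha>)\<^sup>2)"
      by (simp add: power2_eq_square algebra_simps)
    then have "2 * (cmod \<alpha>)\<^sup>2 \<le> (s m)\<^sup>2 * \<epsilon> * (cmod \<alpha>)\<^sup>2" using pos by simp
    also have "(s m)\<^sup>2 * \<epsilon> \<le> 1" unfolding \<epsilon>_def by (simp add: divide_le_eq_1_pos add_nonneg_pos)
    then have "(s m)\<^sup>2 * \<epsilon> * (cmod \<alpha>)\<^sup>2 \<le> 1 * (cmod \<alpha>)\<^sup>2" by (rule mult_right_mono) simp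
    finally have "\<alpha> = 0" by simp
    then show ?thesis using ell2_inner_commute[OF z2 z2, of m n] by (simp add: \<alpha>_def)
  qed
  \<comment> \<open>If \<open>y\<close> has finite rank, the normalised images run out and the sequence is continued by arbitrary
    orthonormal vectors; this is consistent because \<open>s\<close> is decreasing, so no image comes after them.\<close>
  define Q where "Q u n w \<longleftrightarrow> (if 0 < s n then w = (\<lambda>i. complex_of_real (1 / s n) * z n i)
      else w \<in> ell2 \<and> sqnorm w = 1 \<and> (\<forall>k<n. ell2_inner w (u k) = 0))"
    for u :: "nat \<Rightarrow> nat \<Rightarrow> complex" and n w
  have Q2: "w \<in> ell2" if "Q u n w" for u n w
    using that ell2_scale[OF z2[of n], of "complex_of_real (1 / s n)"] by (auto simp: Q_def split: if_splits)
  have "\<exists>u. \<forall>n. Q u n (u n)"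
  proof (rule dependent_wellorder_choice)
    show "Q f n w = Q g n w" if "\<And>k. k < n \<Longrightarrow> f k = g k" for f g n w
      using that by (simp add: Q_def)
    show "\<exists>w. Q f n w" if "\<And>k. k < n \<Longrightarrow> Q f k (f k)" for f n
      using exists_orthogonal_unit_vector[of n f] Q2[OF that] unfolding Q_def by auto
  qed
  then obtain u where u: "\<And>n. Q u n (u n)" by blast
  have us: "orthonormal_seq u"
  proof (rule orthonormal_seqI)
    show u2: "u n \<in> ell2" for n using Q2[OF u] .
    show "sqnorm (u n) = 1" for n
    proof (cases "0 < s n")
      case True
      with u[of n] have "u n = (\<lambda>i. complex_of_real (1 / s n) * z n i)" by (simp add: Q_def)
      then have "sqnorm (u n) = (1 / s n)\<^sup>2 * (s n)\<^sup>2"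
        using True by (simp only: sqnorm_scale[OF z2] ss) (simp add: norm_divide)
      then show ?thesis using True by (simp add: power_divide)
    qed (use u[of n] in \<open>auto simp: Q_def\<close>)
    show "ell2_inner (u n) (u m) = 0" if "m < n" for m n
    proof (cases "0 < s n")
      case True
      then have "0 < s m" using decseqD[OF dec, of m n] that by simp
      with u[of m] have um: "u m = (\<lambda>i. complex_of_real (1 / s m) * z m i)" by (simp add: Q_def)
      from True u[of n] have un: "u n = (\<lambda>i. complex_of_real (1 / s n) * z n i)" by (simp add: Q_def)
      have "ell2_inner (u m) (z n) = 0"
        unfolding um ell2_inner_scale_left[OF z2 z2] using zo[OF that] ell2_inner_commute[OF z2 z2, of n m] by simp
      then have "ell2_inner (z n) (u m) = 0" using ell2_inner_commute[OF u2 z2, of n m] by simp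
      then show ?thesis unfolding un ell2_inner_scale_left[OF z2 u2] by simp
    qed (use u[of n] that in \<open>auto simp: Q_def\<close>)
  qed
  have uz: "complex_of_real (s n) * u n i = z n i" for n i
  proof (cases "0 < s n")
    case False
    then have "sqnorm (z n) = 0" using s0[of n] ss[of n] by simp
    then have "z n i = 0" using coord_le_sqnorm[OF z2, of n i] by simp
    then show ?thesis using False s0[of n] by simp
  qed (use u[of n] in \<open>auto simp: Q_def\<close>)
  have "(\<lambda>n. complex_of_real (s n) * u n i * cnj (v n j)) sums y i j" for i j
    unfolding uz sums_def
  proof (rule LIM_zero_cancel, rule Lim_null_comparison[OF _ lim], rule always_eventually, rule allI)
    fix N
    define h where "h = (\<lambda>l. std_vec j l - (\<Sum>k\<in>{..<N}. ell2_inner (std_vec j) (v k) * v k l))"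
    note res = orthonormal_residual[where A = "{..<N}" and a = "std_vec j",
        OF orthonormal_on_seq[OF vs] finite_lessThan std_vec_ell2, folded h_def]
    have "ell2_inner h (v k) = 0" if "k < N" for k using res(2) that by simp
    from vmax[OF res(1) this] have le: "sqnorm (mat_app y h) \<le> (s N)\<^sup>2 * sqnorm h"
      by (simp add: ss z_def)
    have "sqnorm h \<le> 1"
      using res(3) by (simp add: sqnorm_std_vec sum_nonneg)
    with le have le: "sqnorm (mat_app y h) \<le> (s N)\<^sup>2"
      using mult_left_le[of "sqnorm h" "(s N)\<^sup>2"] by simp
    have L2: "(\<lambda>l. \<Sum>k\<in>{..<N}. ell2_inner (std_vec j) (v k) * v k l) \<in> ell2"
      using v2 by (intro ell2_lincomb)
    have yc: "(\<lambda>j. cnj (y i j)) \<in> ell2" using y2 by (simp add: ell2_cnj)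
    have "mat_app y h i = y i j - (\<Sum>k<N. z k i * cnj (v k j))"
      unfolding h_def mat_app_def ell2_inner_diff_left[OF std_vec_ell2 L2 yc]
        ell2_inner_lincomb_left[OF v2 yc]
      by (simp add: ell2_inner_std_vec z_def mat_app_def mult.commute)
    then have "(cmod ((\<Sum>k<N. z k i * cnj (v k j)) - y i j))\<^sup>2 \<le> (s N)\<^sup>2"
      using coord_le_sqnorm[OF mat_app_ell2[OF y res(1)], of i] le by (simp add: norm_minus_commute)
    then show "norm ((\<Sum>k<N. z k i * cnj (v k j)) - y i j) \<le> s N"
      using s0 by (rule power2_le_imp_le)
  qed
  then have "is_svd y s u v"
    using s0 dec lim us vs by (simp add: is_svd_def)
  then show ?thesis by blast
qed

section \<open>Weights give bounded multipliers\<close>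

text \<open>
  Hoelder's inequality for series, obtained by summing Young's inequality for the normalised terms.
\<close>

lemma suminf_powr_mult_le:
  fixes f q :: "nat \<Rightarrow> real"
  assumes f: "summable f" "\<And>i. 0 \<le> f i" and q: "summable q" "\<And>i. 0 \<le> q i"
    and \<alpha>: "0 < \<alpha>" "0 < \<beta>" "\<alpha> + \<beta> = 1"
  shows "summable (\<lambda>i. f i powr \<alpha> * q i powr \<beta>)"
    and "(\<Sum>i. f i powr \<alpha> * q i powr \<beta>) \<le> (\<Sum>i. f i) powr \<alpha> * (\<Sum>i. q i) powr \<beta>"
proof -
  define F Q where "F = (\<Sum>i. f i)" and "Q = (\<Sum>i. q i)"
  have F0: "0 \<le> F" "0 \<le> Q" unfolding F_def Q_def using assms by (auto intro: suminf_nonneg)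
  have "summable (\<lambda>i. f i powr \<alpha> * q i powr \<beta>) \<and> (\<Sum>i. f i powr \<alpha> * q i powr \<beta>) \<le> F powr \<alpha> * Q powr \<beta>"
  proof (cases "F = 0 \<or> Q = 0")
    case True
    have "f i = 0 \<or> q i = 0" for i
      using True suminf_eq_zero_iff[OF f] suminf_eq_zero_iff[OF q] by (auto simp: F_def Q_def)
    then have "(\<lambda>i. f i powr \<alpha> * q i powr \<beta>) = (\<lambda>i. 0)" by (auto simp: fun_eq_iff)
    then show ?thesis by simp
  next
    case False
    then have pos: "0 < F" "0 < Q" using F0 by auto
    have le: "f i powr \<alpha> * q i powr \<beta> \<le> F powr \<alpha> * Q powr \<beta> * (\<alpha> / F * f i + \<beta> / Q * q i)" for i
    proof (cases "f i = 0 \<or> q i = 0")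
      case True
      have "0 \<le> F powr \<alpha> * Q powr \<beta> * (\<alpha> / F * f i + \<beta> / Q * q i)"
        using f(2)[of i] q(2)[of i] \<alpha> pos by (intro mult_nonneg_nonneg add_nonneg_nonneg) auto
      with True show ?thesis by auto
    next
      case nz: False
      then have fq: "0 < f i" "0 < q i" using f(2)[of i] q(2)[of i] by auto
      have "(f i / F) powr \<alpha> * (q i / Q) powr \<beta> \<le> \<alpha> * (f i / F) + \<beta> * (q i / Q)"
        using \<alpha> fq pos by (intro Youngs_inequality_0) auto
      moreover have "f i powr \<alpha> * q i powr \<beta> =
          F powr \<alpha> * Q powr \<beta> * ((f i / F) powr \<alpha> * (q i / Q) powr \<beta>)"
        using fq pos by (simp add: powr_divide)
      ultimately show ?thesis using pos by (simp add: mult_left_mono)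
    qed
    have "(\<lambda>i. F powr \<alpha> * Q powr \<beta> * (\<alpha> / F * f i + \<beta> / Q * q i)) sums
        (F powr \<alpha> * Q powr \<beta> * (\<alpha> / F * F + \<beta> / Q * Q))"
      unfolding F_def Q_def using f q by (intro sums_mult sums_add summable_sums)
    also have "F powr \<alpha> * Q powr \<beta> * (\<alpha> / F * F + \<beta> / Q * Q) = F powr \<alpha> * Q powr \<beta>"
      using pos \<alpha> by simp
    finally have sums: "(\<lambda>i. F powr \<alpha> * Q powr \<beta> * (\<alpha> / F * f i + \<beta> / Q * q i)) sums (F powr \<alpha> * Q powr \<beta>)" .
    have "summable (\<lambda>i. f i powr \<alpha> * q i powr \<beta>)"
      by (rule summable_comparison_test'[where N = 0, OF sums_summable[OF sums]]) (use le in auto)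
    moreover from this have "(\<Sum>i. f i powr \<alpha> * q i powr \<beta>) \<le> F powr \<alpha> * Q powr \<beta>"
      using sums_le[OF le summable_sums sums] by simp
    ultimately show ?thesis by simp
  qed
  then show "summable (\<lambda>i. f i powr \<alpha> * q i powr \<beta>)"
    "(\<Sum>i. f i powr \<alpha> * q i powr \<beta>) \<le> (\<Sum>i. f i) powr \<alpha> * (\<Sum>i. q i) powr \<beta>"
    by (simp_all add: F_def Q_def)
qed

text \<open>
  Jensen's inequality for the concave function \<open>z \<mapsto> z powr (p / 2)\<close>, in the form of its tangent line
  at \<open>R\<close>. Weights of total mass below 1 are allowed because the tangent line has a nonnegative
  constant term.
\<close>

lemma powr_weighted_average_le:
  fixes t w :: "'n \<Rightarrow> real" and R p :: real
  assumes p: "0 < p" "p \<le> 2" and t: "\<And>n. n \<in> A \<Longrightarrow> 0 \<le> t n" and w: "\<And>n. n \<in> A \<Longrightarrow> 0 \<le> w n"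
    and A: "finite A" and sw: "(\<Sum>n\<in>A. w n) \<le> 1" and R: "(\<Sum>n\<in>A. (t n)\<^sup>2 * w n) \<le> R"
  shows "(\<Sum>n\<in>A. t n powr p * w n) \<le> R powr (p / 2)"
proof (cases "R > 0")
  case False
  have "(\<Sum>n\<in>A. (t n)\<^sup>2 * w n) \<ge> 0" using w by (auto intro!: sum_nonneg)
  then have "(\<Sum>n\<in>A. (t n)\<^sup>2 * w n) = 0" using False R by simp
  then have "\<forall>n\<in>A. (t n)\<^sup>2 * w n = 0"
    using A w by (subst (asm) sum_nonneg_eq_0_iff) auto
  then have "(\<Sum>n\<in>A. t n powr p * w n) = 0"
    by (intro sum.neutral) auto
  then show ?thesis by simp
next
  case True
  define c where "c = R powr (p / 2) / R"
  have young: "t n powr p \<le> (1 - p / 2) * R powr (p / 2) + p / 2 * c * (t n)\<^sup>2" if "n \<in> A" for n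
  proof (cases "t n = 0")
    case True
    then show ?thesis using p by simp
  next
    case False
    then have tn: "0 < t n" using t[OF that] by simp
    have "((t n)\<^sup>2 / R) powr (p / 2) * 1 powr (1 - p / 2) \<le> p / 2 * ((t n)\<^sup>2 / R) + (1 - p / 2) * 1"
      using p tn True by (intro Youngs_inequality_0) auto
    then have "R powr (p / 2) * ((t n)\<^sup>2 / R) powr (p / 2) \<le>
        R powr (p / 2) * (p / 2 * ((t n)\<^sup>2 / R) + (1 - p / 2))"
      by (intro mult_left_mono) auto
    moreover have "((t n)\<^sup>2) powr (p / 2) = t n powr p"
      using tn by (simp add: powr_powr flip: powr_numeral)
    ultimately show ?thesis using True tn by (simp add: powr_divide c_def algebra_simps)
  qed
  have "(\<Sum>n\<in>A. t n powr p * w n) \<le>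
      (\<Sum>n\<in>A. ((1 - p / 2) * R powr (p / 2) + p / 2 * c * (t n)\<^sup>2) * w n)"
    using young w by (intro sum_mono mult_right_mono) auto
  also have "\<dots> = (1 - p / 2) * R powr (p / 2) * (\<Sum>n\<in>A. w n) + p / 2 * c * (\<Sum>n\<in>A. (t n)\<^sup>2 * w n)"
    by (simp only: distrib_right sum.distrib sum_distrib_left mult.assoc)
  also have "\<dots> \<le> (1 - p / 2) * R powr (p / 2) * 1 + p / 2 * c * R"
    using p sw R True by (intro add_mono mult_left_mono) (auto simp: c_def)
  also have "\<dots> = R powr (p / 2)" using True by (simp add: c_def algebra_simps)
  finally show ?thesis .
qed

text \<open>
  For \<open>p \<le> 2\<close> the norms of the rows dominate the singular values in the \<open>p\<close>-norm. The squared norm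
  of row \<open>i\<close> is the sum of \<open>(t n)\<^sup>2\<close> with weights \<open>(cmod (u n i))\<^sup>2\<close>, so Jensen's
  inequality bounds its power \<open>p / 2\<close> below by the sum of \<open>t n powr p\<close> with the same weights. Summed over \<open>i\<close>, the
  weights of each \<open>n\<close> add up to 1.
\<close>

lemma svd_sum_powr_le_rows:
  assumes y: "is_svd y t u v" and p: "0 < p" "p \<le> 2"
    and sum: "summable (\<lambda>i. sqnorm (y i) powr (p / 2))"
  shows "summable (\<lambda>n. t n powr p)" "(\<Sum>n. t n powr p) \<le> (\<Sum>i. sqnorm (y i) powr (p / 2))"
proof -
  have u: "orthonormal_seq u" using y by (simp add: is_svd_def)
  then have u2: "u n \<in> ell2" and un: "sqnorm (u n) = 1" for n
    using ell2_inner_self[of "u n"] by (auto simp: orthonormal_seq_def)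
  have le: "(\<Sum>n<N. t n powr p) \<le> (\<Sum>i. sqnorm (y i) powr (p / 2))" for N
  proof (rule sums_le)
    have "(\<lambda>i. \<Sum>n<N. t n powr p * (cmod (u n i))\<^sup>2) sums (\<Sum>n<N. t n powr p * sqnorm (u n))"
      by (intro sums_sum sums_mult sqnorm_sums u2)
    then show "(\<lambda>i. \<Sum>n<N. t n powr p * (cmod (u n i))\<^sup>2) sums (\<Sum>n<N. t n powr p)"
      by (simp add: un)
    show "(\<lambda>i. sqnorm (y i) powr (p / 2)) sums (\<Sum>i. sqnorm (y i) powr (p / 2))"
      using sum by (rule summable_sums)
    show "(\<Sum>n<N. t n powr p * (cmod (u n i))\<^sup>2) \<le> sqnorm (y i) powr (p / 2)" for i
    proof (rule powr_weighted_average_le[OF p])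
      have "(\<Sum>n<N. (t n)\<^sup>2 * (cmod (u n i))\<^sup>2) = (\<Sum>n<N. (cmod (complex_of_real (t n) * u n i))\<^sup>2)"
        by (simp add: norm_mult power_mult_distrib)
      also have "\<dots> \<le> sqnorm (y i)"
        unfolding svd_row(2)[OF y, of i]
        by (intro sum_le_sqnorm svd_scaled_ell2[OF y] svd_coord_ell2(1)[OF y]) simp
      finally show "(\<Sum>n<N. (t n)\<^sup>2 * (cmod (u n i))\<^sup>2) \<le> sqnorm (y i)" .
    qed (use svd_nonneg[OF y] svd_coord_ell2(2)[OF y] in auto)
  qed
  then show s: "summable (\<lambda>n. t n powr p)" by (intro summableI_nonneg_bounded) auto
  show "(\<Sum>n. t n powr p) \<le> (\<Sum>i. sqnorm (y i) powr (p / 2))"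
    using s le by (rule suminf_le_const)
qed

text \<open>
  The squared row norms are again sums of \<open>(s n)\<^sup>2\<close> with weights \<open>(cmod (u n i))\<^sup>2\<close>; summing over
  finitely many \<open>i\<close> first, the weights of each \<open>n\<close> add up to at most 1.
\<close>

lemma svd_sum_rows_le:
  assumes x: "is_svd x s u v" and sum: "summable (\<lambda>n. (s n)\<^sup>2)"
  shows "hilbert_schmidt x" "(\<Sum>i. sqnorm (x i)) \<le> (\<Sum>n. (s n)\<^sup>2)"
proof -
  have le: "(\<Sum>i<N. sqnorm (x i)) \<le> (\<Sum>n. (s n)\<^sup>2)" for N
  proof (rule sums_le)
    show "(\<lambda>n. \<Sum>i<N. (cmod (complex_of_real (s n) * u n i))\<^sup>2) sums (\<Sum>i<N. sqnorm (x i))"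
      unfolding svd_row(2)[OF x]
      by (intro sums_sum sqnorm_sums svd_scaled_ell2[OF x] svd_coord_ell2(1)[OF x])
    show "(\<lambda>n. (s n)\<^sup>2) sums (\<Sum>n. (s n)\<^sup>2)" using sum by (rule summable_sums)
    show "(\<Sum>i<N. (cmod (complex_of_real (s n) * u n i))\<^sup>2) \<le> (s n)\<^sup>2" for n
    proof -
      have u: "u n \<in> ell2" "sqnorm (u n) = 1"
        using x ell2_inner_self[of "u n"] by (auto simp: is_svd_def orthonormal_seq_def)
      have "(\<Sum>i<N. (cmod (complex_of_real (s n) * u n i))\<^sup>2) = (s n)\<^sup>2 * (\<Sum>i<N. (cmod (u n i))\<^sup>2)"
        by (simp add: norm_mult power_mult_distrib sum_distrib_left)
      also have "\<dots> \<le> (s n)\<^sup>2 * 1"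
        using sum_le_sqnorm[OF u(1), of "{..<N}"] u(2) by (intro mult_left_mono) auto
      finally show ?thesis by simp
    qed
  qed
  have x2: "x i \<in> ell2" for i using svd_row(1)[OF x] .
  with le have s: "summable (\<lambda>i. sqnorm (x i))"
    by (intro summableI_nonneg_bounded) (auto intro: sqnorm_nonneg)
  with x2 show "hilbert_schmidt x" by (simp add: hilbert_schmidt_def)
  show "(\<Sum>i. sqnorm (x i)) \<le> (\<Sum>n. (s n)\<^sup>2)"
    using s le by (rule suminf_le_const)
qed

text \<open>
  If \<open>z\<close> is dominated by \<open>x\<close> with its rows multiplied by a sequence in \<open>\<ell>\<^sub>r\<close>, then Hoelder's
  inequality with \<open>p / r + p / 2 = 1\<close> puts the sequence of its row norms into \<open>\<ell>\<^sub>p\<close>. This plays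
  the role of the Hoelder inequality between \<open>S\<^sub>r\<close> and \<open>S\<^sub>2\<close>.
\<close>

lemma svd_exists_row_weighted:
  assumes x: "is_svd x s u v" and sum: "summable (\<lambda>n. (s n)\<^sup>2)"
    and f: "summable f" "\<And>i. 0 \<le> f i"
    and pr: "0 < p" "0 < r" "1 / r = 1 / p - 1 / 2"
    and z: "\<And>i j. cmod (z i j) \<le> 2 * f i powr (1 / r) * cmod (x i j)"
  shows "\<exists>a u v. is_svd z a u v \<and> summable (\<lambda>n. a n powr p) \<and>
    (\<Sum>n. a n powr p) \<le> 2 powr p * (\<Sum>i. f i) powr (p / r) * (\<Sum>n. (s n)\<^sup>2) powr (p / 2)"
proof -
  define F where "F = (\<Sum>i. f i)"
  have exps: "p / r + p / 2 = 1" using pr by (simp add: field_simps)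
  have p2: "p \<le> 2" using exps pr divide_pos_pos[of p r] by linarith
  have xhs: "\<And>i. x i \<in> ell2" "summable (\<lambda>i. sqnorm (x i))"
    using svd_sum_rows_le(1)[OF x sum] by (auto simp: hilbert_schmidt_def)
  have z2: "z i \<in> ell2" and zle: "sqnorm (z i) \<le> (2 * f i powr (1 / r))\<^sup>2 * sqnorm (x i)" for i
    using ell2_comparison[OF xhs(1)[of i] z[of i]] by auto
  have fF: "f i \<le> F" for i
    unfolding F_def using sum_le_suminf[OF f(1), of "{i}"] f(2) by simp
  have zle': "sqnorm (z i) \<le> (2 * F powr (1 / r))\<^sup>2 * sqnorm (x i)" for i
    using fF f(2) pr(2)
    by (intro order_trans[OF zle] mult_right_mono power_mono mult_left_mono powr_mono2 sqnorm_nonneg xhs) auto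
  have "summable (\<lambda>i. sqnorm (z i))"
    by (rule summable_comparison_test'[where N = 0, OF summable_mult[OF xhs(2), of "(2 * F powr (1 / r))\<^sup>2"]])
      (use zle' sqnorm_nonneg[OF z2] in auto)
  then have "hilbert_schmidt z" using z2 by (simp add: hilbert_schmidt_def)
  from hilbert_schmidt_svd_exists[OF this] obtain a u' v' where a: "is_svd z a u' v'" by blast
  define h where "h i = f i powr (p / r) * sqnorm (x i) powr (p / 2)" for i
  have h: "summable h" "(\<Sum>i. h i) \<le> F powr (p / r) * (\<Sum>i. sqnorm (x i)) powr (p / 2)"
    unfolding h_def F_def using f xhs exps pr
    by (intro suminf_powr_mult_le; auto intro: sqnorm_nonneg)+
  have zh: "sqnorm (z i) powr (p / 2) \<le> 2 powr p * h i" for i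
  proof -
    have "sqnorm (z i) powr (p / 2) \<le> ((2 * f i powr (1 / r))\<^sup>2 * sqnorm (x i)) powr (p / 2)"
      using zle pr sqnorm_nonneg[OF z2] by (intro powr_mono2) auto
    also have "\<dots> = 2 powr p * h i"
    proof -
      have "((2 * f i powr (1 / r))\<^sup>2) powr (p / 2) = (2 * f i powr (1 / r)) powr p"
      proof (cases "f i = 0")
        case False
        then have "0 < 2 * f i powr (1 / r)" using f(2)[of i] by simp
        then show ?thesis by (simp only: powr_numeral[symmetric] powr_powr) simp
      qed simp
      also have "\<dots> = 2 powr p * f i powr (p / r)"
        using f(2)[of i] by (simp add: powr_mult powr_powr)
      finally show ?thesis using sqnorm_nonneg[OF xhs(1)] by (simp add: powr_mult h_def)
    qed
    finally show ?thesis .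
  qed
  have sz: "summable (\<lambda>i. sqnorm (z i) powr (p / 2))"
    by (rule summable_comparison_test'[where N = 0, OF summable_mult[OF h(1), of "2 powr p"]]) (use zh in auto)
  have "(\<Sum>n. a n powr p) \<le> (\<Sum>i. sqnorm (z i) powr (p / 2))"
    by (rule svd_sum_powr_le_rows(2)[OF a pr(1) p2 sz])
  also have "\<dots> \<le> (\<Sum>i. 2 powr p * h i)"
    using sz h zh by (intro suminf_le summable_mult) auto
  also have "\<dots> = 2 powr p * (\<Sum>i. h i)" using h(1) by (rule suminf_mult)
  also have "\<dots> \<le> 2 powr p * (F powr (p / r) * (\<Sum>n. (s n)\<^sup>2) powr (p / 2))"
  proof (rule mult_left_mono)
    have "(\<Sum>i. sqnorm (x i)) powr (p / 2) \<le> (\<Sum>n. (s n)\<^sup>2) powr (p / 2)"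
      using svd_sum_rows_le(2)[OF x sum] pr xhs by (intro powr_mono2 suminf_nonneg) (auto intro: sqnorm_nonneg)
    then show "(\<Sum>i. h i) \<le> F powr (p / r) * (\<Sum>n. (s n)\<^sup>2) powr (p / 2)"
      using h(2) by (meson mult_left_mono order_trans powr_ge_zero)
  qed simp
  finally show ?thesis
    using a svd_sum_powr_le_rows(1)[OF a pr(1) p2 sz] by (auto simp: F_def mult.assoc)
qed

lemma powr_add_le_two_powr:
  fixes a b p :: real
  assumes "0 \<le> a" "0 \<le> b" "0 < p"
  shows "(a + b) powr p \<le> 2 powr p * (a powr p + b powr p)"
proof -
  have "(a + b) powr p \<le> (2 * max a b) powr p"
    using assms by (intro powr_mono2) auto
  also have "\<dots> = 2 powr p * max a b powr p"
    using assms by (simp add: powr_mult)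
  also have "\<dots> \<le> 2 powr p * (a powr p + b powr p)"
    by (intro mult_left_mono) (auto simp: max_def)
  finally show ?thesis .
qed

text \<open>
  The Weyl inequality bounds both \<open>t (2 * n)\<close> and \<open>t (2 * n + 1)\<close> by \<open>a n + b n\<close>. The constant is
  not optimal, but any constant independent of the matrices serves for boundedness.
\<close>

lemma schatten_quasi_triangle:
  assumes y: "is_svd y t u v" and A: "is_svd A a u1 v1" and B: "is_svd B b u2 v2"
    and add: "\<And>i j. y i j = A i j + B i j" and p: "0 < p"
    and a: "summable (\<lambda>n. a n powr p)" and b: "summable (\<lambda>n. b n powr p)"
  shows "summable (\<lambda>n. t n powr p)"
    "(\<Sum>n. t n powr p) \<le> 2 * 2 powr p * ((\<Sum>n. a n powr p) + (\<Sum>n. b n powr p))"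
proof -
  have t: "t (2 * n) powr p \<le> 2 powr p * (a n powr p + b n powr p)"
     "t (Suc (2 * n)) powr p \<le> 2 powr p * (a n powr p + b n powr p)" for n
  proof -
    have "t (2 * n) \<le> a n + b n"
      using weyl_singular_value_inequality[OF y A B add, of n n] by (simp add: mult_2)
    then have "t (2 * n) powr p \<le> (a n + b n) powr p"
      using p svd_nonneg[OF y] by (intro powr_mono2) auto
    also have "\<dots> \<le> 2 powr p * (a n powr p + b n powr p)"
      using p svd_nonneg[OF A] svd_nonneg[OF B] by (intro powr_add_le_two_powr) auto
    finally show even: "t (2 * n) powr p \<le> 2 powr p * (a n powr p + b n powr p)" .
    have "t (Suc (2 * n)) powr p \<le> t (2 * n) powr p"
      using p svd_nonneg[OF y] svd_antimono[OF y] by (intro powr_mono2) auto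
    with even show "t (Suc (2 * n)) powr p \<le> 2 powr p * (a n powr p + b n powr p)" by simp
  qed
  have "(\<Sum>n<2*N. t n powr p) \<le> (\<Sum>n<N. 2 * (2 powr p * (a n powr p + b n powr p)))" for N
    by (induction N) (use t in \<open>auto intro: add_mono order_trans\<close>, smt (verit) t)
  also have "(\<Sum>n<N. 2 * (2 powr p * (a n powr p + b n powr p))) \<le>
      2 * 2 powr p * ((\<Sum>n. a n powr p) + (\<Sum>n. b n powr p))" for N
  proof -
    have "(\<Sum>n<N. a n powr p) \<le> (\<Sum>n. a n powr p)" "(\<Sum>n<N. b n powr p) \<le> (\<Sum>n. b n powr p)"
      using a b by (auto intro!: sum_le_suminf)
    then have "2 * 2 powr p * ((\<Sum>n<N. a n powr p) + (\<Sum>n<N. b n powr p)) \<le>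
        2 * 2 powr p * ((\<Sum>n. a n powr p) + (\<Sum>n. b n powr p))"
      by (intro mult_left_mono add_mono) auto
    then show ?thesis by (simp add: sum_distrib_left sum.distrib algebra_simps)
  qed
  finally have double: "(\<Sum>n<2*N. t n powr p) \<le> 2 * 2 powr p * ((\<Sum>n. a n powr p) + (\<Sum>n. b n powr p))" for N .
  have le: "(\<Sum>n<N. t n powr p) \<le> 2 * 2 powr p * ((\<Sum>n. a n powr p) + (\<Sum>n. b n powr p))" for N
    by (rule order_trans[OF sum_mono2 double[of N]]) auto
  then show s: "summable (\<lambda>n. t n powr p)" by (intro summableI_nonneg_bounded) auto
  show "(\<Sum>n. t n powr p) \<le> 2 * 2 powr p * ((\<Sum>n. a n powr p) + (\<Sum>n. b n powr p))"
    using s le by (rule suminf_le_const)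
qed

lemma schur_mult_bounded_if_weights:
  fixes p r :: real
  assumes p: "0 < p" and r: "0 < r" and pr: "1 / r = 1 / p - 1 / 2"
    and f: "\<And>i. 0 \<le> f i" "summable f"
    and \<phi>: "\<And>i j. cmod (\<phi> i j) \<le> f i powr (1 / r) + f j powr (1 / r)"
  shows "schatten_bounded 2 p (schur_mult \<phi>)"
proof -
  \<comment> \<open>The outer factor comes from the quasi-triangle inequality, the inner one from the two weighted parts.\<close>
  define K where "K = 2 * 2 powr p * (2 * (2 powr p * (\<Sum>i. f i) powr (p / r)))"
  have K0: "0 \<le> K" by (simp add: K_def)
  have "schur_mult \<phi> x \<in> schatten_class p \<and>
      schatten_norm p (schur_mult \<phi> x) \<le> K powr (1 / p) * schatten_norm 2 x"
    if x: "x \<in> schatten_class 2" for x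
  proof -
    define s where "s = singular_values x"
    obtain s' where "has_singular_values x s'" using x by (auto simp: schatten_class_def)
    then have "has_singular_values x s" by (simp add: s_def singular_values_eq)
    then obtain u v where s: "is_svd x s u v" by (auto simp: has_singular_values_iff_svd)
    have s2: "s n powr 2 = (s n)\<^sup>2" for n
      using svd_nonneg[OF s, of n] by simp
    have "summable (\<lambda>n. s n powr 2)"
      using x by (simp add: schatten_class_def s_def)
    then have sum: "summable (\<lambda>n. (s n)\<^sup>2)" by (simp add: s2)
    define X where "X = (\<Sum>n. (s n)\<^sup>2)"
    have X0: "0 \<le> X" unfolding X_def using sum by (intro suminf_nonneg) auto
    \<comment> \<open>Where \<open>f j \<le> f i\<close> the multiplier is at most twice a function of the row, elsewhere at most twice
      a function of the column.\<close>
    define A where "A i j = (if f j \<le> f i then x i j * \<phi> i j else 0)" for i j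
    define B where "B i j = (if f j \<le> f i then 0 else x i j * \<phi> i j)" for i j
    have Ale: "cmod (A i j) \<le> 2 * f i powr (1 / r) * cmod (x i j)"
      and Ble: "cmod (B i j) \<le> 2 * f j powr (1 / r) * cmod (x i j)" for i j
    proof -
      show "cmod (A i j) \<le> 2 * f i powr (1 / r) * cmod (x i j)"
      proof (cases "f j \<le> f i")
        case True
        then have "f j powr (1 / r) \<le> f i powr (1 / r)" using f r by (intro powr_mono2) auto
        then have "cmod (\<phi> i j) \<le> 2 * f i powr (1 / r)" using \<phi>[of i j] by simp
        from mult_right_mono[OF this, of "cmod (x i j)"] True show ?thesis
          by (simp add: A_def norm_mult mult.commute)
      qed (simp add: A_def)
      show "cmod (B i j) \<le> 2 * f j powr (1 / r) * cmod (x i j)"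
      proof (cases "f j \<le> f i")
        case False
        then have "f i powr (1 / r) \<le> f j powr (1 / r)" using f r by (intro powr_mono2) auto
        then have "cmod (\<phi> i j) \<le> 2 * f j powr (1 / r)" using \<phi>[of i j] by simp
        from mult_right_mono[OF this, of "cmod (x i j)"] False show ?thesis
          by (simp add: B_def norm_mult mult.commute)
      qed (simp add: B_def)
    qed
    from svd_exists_row_weighted[OF s sum f(2,1) p r pr Ale] obtain a u1 v1
      where a: "is_svd A a u1 v1" "summable (\<lambda>n. a n powr p)"
        "(\<Sum>n. a n powr p) \<le> 2 powr p * (\<Sum>i. f i) powr (p / r) * X powr (p / 2)"
      unfolding X_def by blast
    from svd_exists_row_weighted[OF svd_transpose[OF s] sum f(2,1) p r pr, of "\<lambda>i j. B j i", OF Ble]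
    obtain b u2 v2
      where b: "is_svd (\<lambda>i j. B j i) b u2 v2" "summable (\<lambda>n. b n powr p)"
        "(\<Sum>n. b n powr p) \<le> 2 powr p * (\<Sum>i. f i) powr (p / r) * X powr (p / 2)"
      unfolding X_def by blast
    note B = svd_transpose[OF b(1)]
    have add: "schur_mult \<phi> x i j = A i j + B i j" for i j
      by (simp add: A_def B_def schur_mult_def)
    have "hilbert_schmidt (schur_mult \<phi> x)"
    proof -
      define F where "F = (\<Sum>i. f i)"
      have fF: "f i powr (1 / r) \<le> F powr (1 / r)" for i
        unfolding F_def using sum_le_suminf[OF f(2), of "{i}"] f r by (intro powr_mono2) auto
      have "cmod (schur_mult \<phi> x i j) \<le> 2 * F powr (1 / r) * cmod (x i j)" for i j
        using mult_right_mono[OF order_trans[OF \<phi> add_mono[OF fF fF]], of "cmod (x i j)" i j]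
        by (simp add: schur_mult_def norm_mult mult.commute)
      note c = ell2_comparison[OF svd_row(1)[OF s] this]
      have "summable (\<lambda>i. sqnorm (x i))" using svd_sum_rows_le(1)[OF s sum] by (simp add: hilbert_schmidt_def)
      from summable_comparison_test'[where N = 0, OF summable_mult[OF this, of "(2 * F powr (1 / r))\<^sup>2"], of "\<lambda>i. sqnorm (schur_mult \<phi> x i)"]
      show ?thesis using c sqnorm_nonneg[OF c(1)] by (simp add: hilbert_schmidt_def)
    qed
    from hilbert_schmidt_svd_exists[OF this] obtain t u' v' where t: "is_svd (schur_mult \<phi> x) t u' v'" by blast
    have ts: "singular_values (schur_mult \<phi> x) = t"
      using t by (intro singular_values_eq) (auto simp: has_singular_values_iff_svd)
    note q = schatten_quasi_triangle[OF t a(1) B add p a(2) b(2)]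
    have "(\<Sum>n. t n powr p) \<le> 2 * 2 powr p * ((\<Sum>n. a n powr p) + (\<Sum>n. b n powr p))" by (fact q(2))
    also have "\<dots> \<le> 2 * 2 powr p * (2 * (2 powr p * (\<Sum>i. f i) powr (p / r) * X powr (p / 2)))"
      using a(3) b(3) by (intro mult_left_mono) auto
    also have "\<dots> = K * X powr (p / 2)" by (simp add: K_def)
    finally have "(\<Sum>n. t n powr p) powr (1 / p) \<le> (K * X powr (p / 2)) powr (1 / p)"
      using p q(1) by (intro powr_mono2 suminf_nonneg) auto
    also have "\<dots> = K powr (1 / p) * X powr (1 / 2)"
      using p K0 by (simp add: powr_mult powr_powr)
    also have "\<dots> = K powr (1 / p) * schatten_norm 2 x"
      unfolding schatten_norm_def s_def[symmetric] by (simp add: X_def s2)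
    finally show ?thesis
      using q(1) t by (auto simp: schatten_class_def schatten_norm_def ts has_singular_values_iff_svd)
  qed
  then show ?thesis unfolding schatten_bounded_def by blast
qed

section \<open>Bounded multipliers give weights\<close>

text \<open>
  Repeatedly choose an entry that is at least half of the supremum \<open>g k\<close> of the entries in the
  remaining rows and columns, and delete its row and column. The factor 2 pays for suprema that are
  not attained. The recorded quantity is the supremum instead of the chosen entry, because the
  suprema decrease by construction.
\<close>

lemma greedy_matching:
  fixes c :: "nat \<Rightarrow> nat \<Rightarrow> real"
  assumes c0: "\<And>i j. 0 \<le> c i j" and cM: "\<And>i j. c i j \<le> M"
  obtains a b g where "inj a" "inj b" "decseq g" "\<And>k. 0 \<le> g k" "\<And>k. g k \<le> 2 * c (a k) (b k)"
    "\<And>k i j. i \<notin> a ` {..<k} \<Longrightarrow> j \<notin> b ` {..<k} \<Longrightarrow> c i j \<le> g k"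
proof -
  define R where "R e n = (- (\<lambda>k. fst (e k)) ` {..<n}) \<times> (- (\<lambda>k. snd (e k)) ` {..<n})"
    for e :: "nat \<Rightarrow> nat \<times> nat" and n :: nat
  define S where "S e n = (SUP (i, j)\<in>R e n. c i j)" for e n
  have ne: "R e n \<noteq> {}" for e n
    using ex_new_if_finite[of "(\<lambda>k. fst (e k)) ` {..<n}"] ex_new_if_finite[of "(\<lambda>k. snd (e k)) ` {..<n}"]
    by (auto simp: R_def)
  have bdd: "bdd_above ((\<lambda>(i, j). c i j) ` A)" for A
    using cM by (intro bdd_aboveI[of _ M]) auto
  have upper: "c i j \<le> S e n" if "(i, j) \<in> R e n" for e n i j
    unfolding S_def using cSUP_upper[OF that bdd] by simp
  have S0: "0 \<le> S e n" for e n
    using ne[of e n] upper c0 by (metis all_not_in_conv order_trans surj_pair)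
  define P where "P e n x \<longleftrightarrow> x \<in> R e n \<and> S e n \<le> 2 * c (fst x) (snd x)" for e n x
  \<comment> \<open>If the supremum vanishes, every remaining entry qualifies, so the choice never stops.\<close>
  have "\<exists>e. \<forall>n. P e n (e n)"
  proof (rule dependent_wellorder_choice)
    show "P e n x = P e' n x" if "\<And>k. k < n \<Longrightarrow> e k = e' k" for e e' n x
    proof -
      have "R e n = R e' n" using that by (simp add: R_def)
      then show ?thesis by (simp add: P_def S_def)
    qed
    show "\<exists>x. P e n x" for e n
    proof (cases "S e n = 0")
      case True
      then show ?thesis using ne[of e n] c0 by (auto simp: P_def)
    next
      case False
      then have "S e n / 2 < S e n" using S0[of e n] by simp
      then obtain x where "x \<in> R e n" "S e n / 2 < (case x of (i, j) \<Rightarrow> c i j)"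
        using less_cSUP_iff[OF ne[of e n] bdd, of "S e n / 2"] unfolding S_def by blast
      then show ?thesis by (intro exI[of _ x]) (auto simp: P_def split: prod.splits)
    qed
  qed
  then obtain e where e: "\<And>n. P e n (e n)" by blast
  show thesis
  proof (rule that)
    have "fst (e m) \<noteq> fst (e n)" "snd (e m) \<noteq> snd (e n)" if "m < n" for m n
      using e[of n] that by (auto simp: P_def R_def)
    then show "inj (\<lambda>k. fst (e k))" "inj (\<lambda>k. snd (e k))"
      by (auto intro!: linorder_injI)
    show "decseq (S e)"
      unfolding decseq_def S_def
    proof (intro allI impI cSUP_subset_mono ne bdd)
      show "R e n \<subseteq> R e m" if "m \<le> n" for m n
        using that by (fastforce simp: R_def)
    qed auto
    show "0 \<le> S e k" for k by (rule S0)
    show "S e k \<le> 2 * c (fst (e k)) (snd (e k))" for k using e[of k] by (simp add: P_def)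
    show "c i j \<le> S e k" if "i \<notin> (\<lambda>k. fst (e k)) ` {..<k}" "j \<notin> (\<lambda>k. snd (e k)) ` {..<k}" for i j k
      using that by (intro upper) (simp add: R_def)
  qed
qed

text \<open>
  A bounded multiplier is tested on a matrix \<open>x\<close> supported on the first \<open>N\<close> places of a matching.
  Its entries are \<open>g k powr (r / 2 + 1)\<close> divided by the multiplier, so that the image has the
  decreasing entries \<open>g k powr (r / 2 + 1)\<close>, which are its singular values. As \<open>g k\<close> is at most
  twice the multiplier, the entries of \<open>x\<close> are at most \<open>2 * g k powr (r / 2)\<close>. With \<open>G\<close> the sum of
  the \<open>g k powr r\<close>, boundedness reads \<open>G powr (1 / p) \<le> C * 2 * G powr (1 / 2)\<close>, since
  \<open>(r / 2 + 1) * p = r\<close>; this is the claim because \<open>1 / p - 1 / 2 = 1 / r\<close>.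
\<close>

lemma matching_sum_le:
  fixes p r C :: real
  assumes p: "0 < p" and r: "0 < r" and pr: "1 / r = 1 / p - 1 / 2"
    and bounded: "\<And>x. x \<in> schatten_class 2 \<Longrightarrow> schatten_norm p (schur_mult \<phi> x) \<le> C * schatten_norm 2 x"
    and C: "0 \<le> C"
    and ab: "inj a" "inj b" and g: "decseq g" "\<And>k. 0 \<le> g k" "\<And>k. g k \<le> 2 * cmod (\<phi> (a k) (b k))"
  shows "(\<Sum>k<N. g k powr r) \<le> (2 * C) powr r"
proof -
  define D where "D e = (\<lambda>i j. if \<exists>n. i = a n \<and> j = b n then complex_of_real (e (inv a i)) else 0)" for e
  \<comment> \<open>The exponent \<open>q\<close> is \<open>r / 2 + 1\<close> for the image and \<open>r / 2\<close> for the majorant of \<open>x\<close>.\<close>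
  define e where "e q k = (if k < N then g k powr q else 0)" for q k
  have D: "is_svd (D (e q)) (e q) (\<lambda>n. std_vec (a n)) (\<lambda>n. std_vec (b n))" if "0 < q" for q
    unfolding D_def
  proof (rule svd_generalized_permutation[OF ab])
    show "0 \<le> e q n" for n by (simp add: e_def)
    show "decseq (e q)"
      unfolding decseq_def e_def using g that by (auto intro!: powr_mono2 simp: decseqD)
    have "\<forall>\<^sub>F n in sequentially. e q n = 0"
      using eventually_ge_at_top[of N] by eventually_elim (simp add: e_def)
    then show "e q \<longlonglongrightarrow> 0" by (rule tendsto_eventually)
  qed
  have esums: "(\<lambda>n. e q n powr t) sums (\<Sum>k<N. g k powr (q * t))" if "0 < t" for q t
  proof -
    have "(\<lambda>n. if n \<in> {..<N} then g n powr (q * t) else 0) sums (\<Sum>k<N. g k powr (q * t))"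
      by (intro sums_If_finite_set) simp
    moreover have "(\<lambda>n. if n \<in> {..<N} then g n powr (q * t) else 0) = (\<lambda>n. e q n powr t)"
      using that by (auto simp: e_def powr_powr)
    ultimately show ?thesis by simp
  qed
  define G where "G = (\<Sum>k<N. g k powr r)"
  \<comment> \<open>A zero of the multiplier on the matching forces \<open>g k = 0\<close>, so dividing by it does no harm.\<close>
  define x where "x i j = D (e (r / 2 + 1)) i j / \<phi> i j" for i j
  have "D (e (r / 2 + 1)) i j = 0" if "\<phi> i j = 0" for i j
  proof (cases "\<exists>n. i = a n \<and> j = b n")
    case True
    then obtain n where "i = a n" "j = b n" by blast
    then show ?thesis using g(2,3)[of n] that by (auto simp: D_def e_def ab)
  qed (auto simp: D_def)
  then have ux: "schur_mult \<phi> x = D (e (r / 2 + 1))"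
    by (auto simp: schur_mult_def x_def fun_eq_iff)
  have xle: "cmod (x i j) \<le> 2 * cmod (D (e (r / 2)) i j)" for i j
  proof (cases "\<exists>n. n < N \<and> i = a n \<and> j = b n \<and> g n \<noteq> 0")
    case True
    then obtain n where n: "n < N" "i = a n" "j = b n" "g n \<noteq> 0" by blast
    then have pos: "0 < g n" "0 < cmod (\<phi> (a n) (b n))" using g(2,3)[of n] by auto
    have "cmod (x i j) = g n powr (r / 2) * (g n / cmod (\<phi> (a n) (b n)))"
      using n pos by (auto simp: x_def D_def e_def ab norm_divide norm_mult powr_add)
    also have "\<dots> \<le> g n powr (r / 2) * 2"
      using pos g(3)[of n] by (intro mult_left_mono) (auto simp: divide_le_eq)
    finally show ?thesis using n by (auto simp: D_def e_def ab)
  next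
    case False
    then have "D (e (r / 2 + 1)) i j = 0" by (auto simp: D_def e_def ab)
    then show ?thesis by (simp add: x_def)
  qed
  have r2: "0 < r / 2" "0 < r / 2 + 1" using r by auto
  have e2: "(\<lambda>n. (e (r / 2) n)\<^sup>2) sums G"
    using esums[of 2 "r / 2"] svd_nonneg[OF D[OF r2(1)]] by (simp add: G_def)
  have Dhs: "\<And>i. D (e (r / 2)) i \<in> ell2" "summable (\<lambda>i. sqnorm (D (e (r / 2)) i))"
    "(\<Sum>i. sqnorm (D (e (r / 2)) i)) \<le> G"
    using svd_sum_rows_le[OF D[OF r2(1)] sums_summable[OF e2]] e2
    by (auto simp: hilbert_schmidt_def sums_iff)
  note xD = ell2_comparison[OF Dhs(1) xle]
  have sx: "summable (\<lambda>i. sqnorm (x i))"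
    by (rule summable_comparison_test'[where N = 0, OF summable_mult[OF Dhs(2), of 4]])
      (use xD sqnorm_nonneg[OF xD(1)] in auto)
  then have "hilbert_schmidt x" using xD by (simp add: hilbert_schmidt_def)
  from hilbert_schmidt_svd_exists[OF this] obtain s u v where s: "is_svd x s u v" by blast
  have row: "(\<lambda>i. sqnorm (x i) powr (2 / 2)) = (\<lambda>i. sqnorm (x i))"
    using sqnorm_nonneg[OF xD(1)] by simp
  note sum = svd_sum_powr_le_rows[OF s, of 2, unfolded row, OF _ _ sx]
  have "(\<Sum>n. s n powr 2) \<le> (\<Sum>i. sqnorm (x i))" using sum(2) by simp
  also have "\<dots> \<le> (\<Sum>i. 4 * sqnorm (D (e (r / 2)) i))"
    using xD(2) sx Dhs(2) by (intro suminf_le summable_mult) auto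
  also have "\<dots> \<le> 4 * G" using Dhs(2,3) by (simp add: suminf_mult)
  finally have s2: "(\<Sum>n. s n powr 2) \<le> 4 * G" .
  have G0: "0 \<le> G" unfolding G_def by (intro sum_nonneg) auto
  have sv: "singular_values x = s" "singular_values (D (e (r / 2 + 1))) = e (r / 2 + 1)"
    using s D[OF r2(2)] has_singular_values_iff_svd by (blast intro: singular_values_eq)+
  have x2: "x \<in> schatten_class 2"
    using s sum(1) by (auto simp: schatten_class_def sv has_singular_values_iff_svd)
  have "(r / 2 + 1) * p = r" using pr p r by (simp add: field_simps)
  then have "(\<lambda>n. e (r / 2 + 1) n powr p) sums G"
    using esums[OF p, of "r / 2 + 1"] by (simp add: G_def)
  then have "schatten_norm p (schur_mult \<phi> x) = G powr (1 / p)"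
    by (simp add: ux schatten_norm_def sv sums_iff)
  with bounded[OF x2] have "G powr (1 / p) \<le> C * schatten_norm 2 x" by simp
  also have "schatten_norm 2 x \<le> (4 * G) powr (1 / 2)"
    unfolding schatten_norm_def sv using s2 sum(1) by (intro powr_mono2 suminf_nonneg) auto
  then have "C * schatten_norm 2 x \<le> C * (4 * G) powr (1 / 2)" using C by (rule mult_left_mono)
  also have "(4 * G) powr (1 / 2) = 2 * G powr (1 / 2)"
    using G0 by (simp add: powr_half_sqrt real_sqrt_mult)
  finally have le: "G powr (1 / p) \<le> 2 * C * G powr (1 / 2)" by (simp add: mult_ac)
  have "G \<le> (2 * C) powr r"
  proof (cases "G = 0")
    case False
    then have pos: "0 < G" using G0 by simp
    have "G powr (1 / r) = G powr (1 / p) / G powr (1 / 2)"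
      unfolding pr by (rule powr_diff)
    also have "\<dots> \<le> 2 * C" using le pos by (simp add: divide_le_eq)
    finally have "(G powr (1 / r)) powr r \<le> (2 * C) powr r"
      using r by (intro powr_mono2) auto
    then show ?thesis using r pos by (simp add: powr_powr)
  qed simp
  then show ?thesis by (simp add: G_def)
qed

text \<open>
  The weight of an index \<open>i\<close> is the sum of \<open>g k powr r\<close> over the steps \<open>k\<close> at which row \<open>i\<close> or
  column \<open>i\<close> was deleted; there is at most one of each kind. As \<open>g\<close> tends to 0, a nonzero entry
  \<open>(i, j)\<close> cannot survive all deletions. At the step \<open>k\<close> that removes it the entry is still present,
  hence bounded by \<open>g k\<close>, and \<open>g k powr r\<close> is part of the weight of \<open>i\<close> or of \<open>j\<close>.
\<close>

lemma weights_if_schur_mult_bounded: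
  fixes p r :: real
  assumes p: "0 < p" and r: "0 < r" and pr: "1 / r = 1 / p - 1 / 2"
    and bdd: "schatten_bounded 2 p (schur_mult \<phi>)"
  shows "\<exists>f. (\<forall>i. 0 \<le> f i) \<and> summable f \<and> (\<forall>i j. cmod (\<phi> i j) \<le> f i powr (1 / r) + f j powr (1 / r))"
proof -
  obtain C0 where C0: "\<And>x. x \<in> schatten_class 2 \<Longrightarrow> schatten_norm p (schur_mult \<phi> x) \<le> C0 * schatten_norm 2 x"
    using bdd by (auto simp: schatten_bounded_def)
  define C where "C = max C0 0"
  have C: "0 \<le> C" by (simp add: C_def)
  have bounded: "schatten_norm p (schur_mult \<phi> x) \<le> C * schatten_norm 2 x" if "x \<in> schatten_class 2" for x
  proof -
    have "C0 * schatten_norm 2 x \<le> C * schatten_norm 2 x"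
      by (intro mult_right_mono) (auto simp: C_def schatten_norm_def)
    with C0[OF that] show ?thesis by simp
  qed
  note matching = matching_sum_le[OF p r pr bounded C]
  \<comment> \<open>A single entry is bounded by testing on a matching that starts there, with \<open>g\<close> zero afterwards.\<close>
  have "cmod (\<phi> i j) \<le> 2 * C" for i j
  proof -
    define g where "g k = (if k = (0::nat) then cmod (\<phi> i j) else 0)" for k
    have "(\<Sum>k<1. g k powr r) \<le> (2 * C) powr r"
    proof (rule matching)
      show "inj (\<lambda>k. k + i)" "inj (\<lambda>k. k + j)" by (auto simp: inj_def)
      show "decseq g" by (auto simp: decseq_def g_def)
      show "0 \<le> g k" "g k \<le> 2 * cmod (\<phi> (k + i) (k + j))" for k by (auto simp: g_def)
    qed
    then have "cmod (\<phi> i j) powr r \<le> (2 * C) powr r" by (simp add: g_def)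
    then show ?thesis using powr_less_mono2[of r "2 * C" "cmod (\<phi> i j)"] r C by (auto simp: not_less[symmetric])
  qed
  then obtain a b g where ab: "inj a" "inj b" and g: "decseq g" "\<And>k. 0 \<le> g k"
    "\<And>k. g k \<le> 2 * cmod (\<phi> (a k) (b k))"
    and cover: "\<And>k i j. i \<notin> a ` {..<k} \<Longrightarrow> j \<notin> b ` {..<k} \<Longrightarrow> cmod (\<phi> i j) \<le> g k"
    using greedy_matching[of "\<lambda>i j. cmod (\<phi> i j)" "2 * C"] by (metis norm_ge_zero)
  have gsum: "(\<Sum>k<N. g k powr r) \<le> (2 * C) powr r" for N
    by (rule matching[OF _ ab g])
  define h where "h a i = (if i \<in> range a then g (inv a i) powr r else 0)" for a :: "nat \<Rightarrow> nat" and i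
  have ha: "h a (a k) = g k powr r" if "inj a" for a k using that by (simp add: h_def)
  have h0: "0 \<le> h a i" for a i by (simp add: h_def)
  have hsum: "summable (h a)" if "inj a" for a
  proof (rule summableI_nonneg_bounded)
    fix I
    have "(\<Sum>i<I. h a i) = (\<Sum>i\<in>{..<I} \<inter> range a. h a i)"
      by (rule sum.mono_neutral_right) (auto simp: h_def)
    also have "{..<I} \<inter> range a = a ` {k. a k < I}" by auto
    also have "(\<Sum>i\<in>\<dots>. h a i) = (\<Sum>k\<in>{k. a k < I}. g k powr r)"
      using that by (subst sum.reindex) (auto simp: ha intro: inj_on_subset)
    also have "finite {k. a k < I}"
      using finite_vimageI[OF finite_lessThan[of I] that] by (simp add: vimage_def)
    then obtain N where "{k. a k < I} \<subseteq> {..<N}" using finite_nat_iff_bounded by blast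
    then have "(\<Sum>k\<in>{k. a k < I}. g k powr r) \<le> (\<Sum>k<N. g k powr r)" by (intro sum_mono2) auto
    also have "\<dots> \<le> (2 * C) powr r" by (rule gsum)
    finally show "(\<Sum>i<I. h a i) \<le> (2 * C) powr r" .
  qed (rule h0)
  define f where "f i = h a i + h b i" for i
  have "(\<lambda>k. g k powr r) \<longlonglongrightarrow> 0"
    by (rule summable_LIMSEQ_zero, rule summableI_nonneg_bounded[OF _ gsum]) auto
  have "cmod (\<phi> i j) \<le> f i powr (1 / r) + f j powr (1 / r)" for i j
  proof (cases "\<phi> i j = 0")
    case False
    then have "0 < cmod (\<phi> i j) powr r" by simp
    with \<open>(\<lambda>k. g k powr r) \<longlonglongrightarrow> 0\<close> have "\<forall>\<^sub>F k in sequentially. g k powr r < cmod (\<phi> i j) powr r"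
      by (rule order_tendstoD)
    then obtain k1 where "g k1 powr r < cmod (\<phi> i j) powr r" by (auto simp: eventually_sequentially)
    then have "g k1 < cmod (\<phi> i j)" using r g(2)[of k1] powr_mono2[of r "cmod (\<phi> i j)" "g k1"] by force
    then have "i \<in> a ` {..<k1} \<or> j \<in> b ` {..<k1}" using cover[of i k1 j] by auto
    then have ex: "\<exists>k. i = a k \<or> j = b k" by blast
    define k where "k = (LEAST k. i = a k \<or> j = b k)"
    have k: "i = a k \<or> j = b k" using LeastI_ex[OF ex] by (simp add: k_def)
    have "\<not> (i = a m \<or> j = b m)" if "m < k" for m
      using that unfolding k_def by (rule not_less_Least)
    then have "i \<notin> a ` {..<k}" "j \<notin> b ` {..<k}" by auto
    then have "cmod (\<phi> i j) \<le> g k" by (rule cover)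
    also have "g k = (g k powr r) powr (1 / r)" using r g(2)[of k] by (simp add: powr_powr)
    also from k have "\<dots> \<le> f i powr (1 / r) + f j powr (1 / r)"
    proof
      assume "i = a k"
      then have "g k powr r \<le> f i" using h0[of b i] by (simp add: f_def ha ab)
      then have "(g k powr r) powr (1 / r) \<le> f i powr (1 / r)" using r by (intro powr_mono2) auto
      then show ?thesis by (simp add: add_increasing2)
    next
      assume "j = b k"
      then have "g k powr r \<le> f j" using h0[of a j] by (simp add: f_def ha ab)
      then have "(g k powr r) powr (1 / r) \<le> f j powr (1 / r)" using r by (intro powr_mono2) auto
      then show ?thesis by (simp add: add_increasing)
    qed
    finally show ?thesis .
  qed simp
  moreover have "summable f" unfolding f_def using ab by (intro summable_add hsum)
  moreover have "0 \<le> f i" for i using h0 by (simp add: f_def)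
  ultimately show ?thesis by blast
qed

section \<open>Weights and decompositions\<close>

text \<open>
  The two descriptions differ only by elementary estimates. Given a decomposition, the suprema of the
  rows of one part and of the columns of the other serve as weights; given weights, an entry is
  assigned to the row part or to the column part according to which of its two weights is larger.
\<close>

lemma decomposition_iff_weights:
  fixes r :: real and \<phi> :: "nat \<Rightarrow> nat \<Rightarrow> complex"
  assumes r: "0 < r"
  shows "(\<exists>\<psi> \<eta> :: nat \<Rightarrow> nat \<Rightarrow> complex.
              (\<forall>i j. \<phi> i j = \<psi> i j + \<eta> i j) \<and>
              (\<Sum>i. SUP j. ennreal (cmod (\<psi> i j) powr r)) < \<infinity> \<and>
              (\<Sum>j. SUP i. ennreal (cmod (\<eta> i j) powr r)) < \<infinity>) \<longleftrightarrow>
         (\<exists>f :: nat \<Rightarrow> real.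
              (\<forall>i. 0 \<le> f i) \<and> summable f \<and>
              (\<forall>i j. cmod (\<phi> i j) \<le> f i powr (1 / r) + f j powr (1 / r)))"
    (is "?D \<longleftrightarrow> ?W")
proof
  have row: "\<exists>F. summable F \<and> (\<forall>i. 0 \<le> F i) \<and> (\<forall>i j. cmod (\<psi> i j) powr r \<le> F i)"
    if fin: "(\<Sum>i. SUP j. ennreal (cmod (\<psi> i j) powr r)) < \<infinity>" for \<psi> :: "nat \<Rightarrow> nat \<Rightarrow> complex"
  proof -
    define F where "F i = enn2real (SUP j. ennreal (cmod (\<psi> i j) powr r))" for i
    have "(SUP j. ennreal (cmod (\<psi> i j) powr r)) < top" for i
      by (rule ennreal_suminf_lessD[OF fin[unfolded infinity_ennreal_def]])
    then have eq: "(SUP j. ennreal (cmod (\<psi> i j) powr r)) = ennreal (F i)" for i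
      unfolding F_def by (rule ennreal_enn2real[symmetric])
    have F0: "0 \<le> F i" for i by (simp add: F_def)
    have "summable F"
      using fin F0 unfolding eq by (intro summable_suminf_not_top) auto
    moreover have "cmod (\<psi> i j) powr r \<le> F i" for i j
    proof -
      have "ennreal (cmod (\<psi> i j) powr r) \<le> ennreal (F i)"
        unfolding eq[symmetric] by (rule SUP_upper) simp
      then show ?thesis using F0 by (simp add: ennreal_le_iff)
    qed
    ultimately show ?thesis using F0 by blast
  qed
  assume ?D
  then obtain \<psi> \<eta> where \<phi>: "\<And>i j. \<phi> i j = \<psi> i j + \<eta> i j"
    and fin: "(\<Sum>i. SUP j. ennreal (cmod (\<psi> i j) powr r)) < \<infinity>"
      "(\<Sum>j. SUP i. ennreal (cmod (\<eta> i j) powr r)) < \<infinity>" by blast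
  obtain F where F: "summable F" "\<And>i. 0 \<le> F i" "\<And>i j. cmod (\<psi> i j) powr r \<le> F i"
    using row[OF fin(1)] by blast
  obtain H where H: "summable H" "\<And>i. 0 \<le> H i" "\<And>i j. cmod (\<eta> j i) powr r \<le> H i"
    using row[of "\<lambda>i j. \<eta> j i", OF fin(2)] by blast
  have root: "cmod w \<le> (x + y) powr (1 / r)" if "cmod w powr r \<le> x" "0 \<le> y" for w :: complex and x y
  proof -
    have "(cmod w powr r) powr (1 / r) \<le> (x + y) powr (1 / r)"
      using that r by (intro powr_mono2) auto
    then show ?thesis using r by (simp add: powr_powr)
  qed
  have "cmod (\<phi> i j) \<le> (F i + H i) powr (1 / r) + (F j + H j) powr (1 / r)" for i j
  proof -
    have "cmod (\<psi> i j) \<le> (F i + H i) powr (1 / r)" using F(3) H(2) by (rule root)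
    moreover have "cmod (\<eta> i j) \<le> (H j + F j) powr (1 / r)" using H(3) F(2) by (rule root)
    ultimately show ?thesis
      unfolding \<phi> using norm_triangle_ineq[of "\<psi> i j" "\<eta> i j"] by (simp add: add.commute)
  qed
  then show ?W
    using F H by (intro exI[of _ "\<lambda>i. F i + H i"]) (auto intro: summable_add)
next
  assume ?W
  then obtain f where f: "\<And>i. 0 \<le> f i" "summable f"
    and \<phi>: "\<And>i j. cmod (\<phi> i j) \<le> f i powr (1 / r) + f j powr (1 / r)" by blast
  define \<psi> where "\<psi> i j = (if f j \<le> f i then \<phi> i j else 0)" for i j
  define \<eta> where "\<eta> i j = (if f j \<le> f i then 0 else \<phi> i j)" for i j
  have le: "cmod (\<phi> i j) powr r \<le> 2 powr r * max (f i) (f j)" for i j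
  proof -
    have "f i powr (1 / r) \<le> max (f i) (f j) powr (1 / r)" "f j powr (1 / r) \<le> max (f i) (f j) powr (1 / r)"
      using f r by (auto intro!: powr_mono2)
    then have "cmod (\<phi> i j) \<le> 2 * max (f i) (f j) powr (1 / r)" using \<phi>[of i j] by simp
    then have "cmod (\<phi> i j) powr r \<le> (2 * max (f i) (f j) powr (1 / r)) powr r"
      using r by (intro powr_mono2) auto
    also have "\<dots> = 2 powr r * max (f i) (f j)"
      using r f(1)[of i] by (simp add: powr_mult powr_powr)
    finally show ?thesis .
  qed
  have fin: "(\<Sum>i. SUP j. ennreal (cmod (z i j) powr r)) < \<infinity>"
    if z: "\<And>i j. cmod (z i j) powr r \<le> 2 powr r * f i" for z :: "nat \<Rightarrow> nat \<Rightarrow> complex"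
  proof -
    have "(\<Sum>i. SUP j. ennreal (cmod (z i j) powr r)) \<le> (\<Sum>i. ennreal (2 powr r * f i))"
      using z by (intro suminf_le SUP_least ennreal_leI) auto
    also have "\<dots> = ennreal (\<Sum>i. 2 powr r * f i)"
      using f by (intro suminf_ennreal2 summable_mult) auto
    finally show ?thesis by (simp add: le_less_trans)
  qed
  have "cmod (\<psi> i j) powr r \<le> 2 powr r * f i" for i j
    using le[of i j] f(1)[of i] by (auto simp: \<psi>_def max_def)
  moreover have "cmod (\<eta> j i) powr r \<le> 2 powr r * f i" for i j
    using le[of j i] f(1)[of i] by (auto simp: \<eta>_def max_def split: if_splits)
  ultimately show ?D
    using fin[of \<psi>] fin[of "\<lambda>i j. \<eta> j i"]
    by (intro exI[of _ \<psi>] exI[of _ \<eta>]) (auto simp: \<psi>_def \<eta>_def)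
qed

theorem theorem5p1:
  fixes p r :: real and \<phi> :: "nat \<Rightarrow> nat \<Rightarrow> complex"
  assumes "0 < p" and "p < 1" and "1 / r = 1 / p - 1 / 2"
  shows "(schatten_bounded 2 p (schur_mult \<phi>) \<longleftrightarrow>
           (\<exists>\<psi> \<eta> :: nat \<Rightarrow> nat \<Rightarrow> complex.
              (\<forall>i j. \<phi> i j = \<psi> i j + \<eta> i j) \<and>
              (\<Sum>i. SUP j. ennreal (cmod (\<psi> i j) powr r)) < \<infinity> \<and>
              (\<Sum>j. SUP i. ennreal (cmod (\<eta> i j) powr r)) < \<infinity>)) \<and>
         (schatten_bounded 2 p (schur_mult \<phi>) \<longleftrightarrow>
           (\<exists>f :: nat \<Rightarrow> real.
              (\<forall>i. 0 \<le> f i) \<and> summable f \<and>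
              (\<forall>i j. cmod (\<phi> i j) \<le> f i powr (1 / r) + f j powr (1 / r))))"
proof -
  have "1 < 1 / p" using assms by simp
  then have "0 < 1 / r" using assms(3) by simp
  then have r: "0 < r" by simp
  have "schatten_bounded 2 p (schur_mult \<phi>) \<longleftrightarrow>
      (\<exists>f. (\<forall>i. 0 \<le> f i) \<and> summable f \<and>
        (\<forall>i j. cmod (\<phi> i j) \<le> f i powr (1 / r) + f j powr (1 / r)))"
    using weights_if_schur_mult_bounded[OF assms(1) r assms(3)]
    by (auto intro: schur_mult_bounded_if_weights[OF assms(1) r assms(3)])
  then show ?thesis
    unfolding decomposition_iff_weights[OF r] by simp
qed

end
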